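(* Let $\mu_1>\mu_2$ be real numbers, $\delta=\mu_1-\mu_2$, $\sigma_1,\sigma_2>0$ and $\alpha_0\in(0,1)$. For the two-phase algorithm with parameter $\alpha_0$ on the two-design problem with independent normal samples $\mathcal{N}(\mu_i,\sigma_i^2)$, $i=1,2$, $$-\lim_{T\to\infty}\frac1T\log\mathrm{PFS}(T)=\min_{p\in[0,1]}\left\{\frac{(1-\alpha_0)\delta^2}{2\left(\frac{\sigma_1^2}{p}+\frac{\sigma_2^2}{1-p}\right)}+\frac{\alpha_0}{2}\log\left(\frac{(1-p)^2\sigma_1^2+p^2\sigma_2^2}{2p(1-p)\sigma_1\sigma_2}\right)\right\}.$$
   Context: There are $K=2$ designs. For $i=1,2$ all samples from design $i$ are i.i.d. $\mathcal{N}(\mu_i,\sigma_i^2)$, and samples from different designs are independent. The two-phase algorithm with parameter $\alpha_0$ and budget $T$ (large enough that $N_0\ge2$ below) is as follows. Phase I: run $N_0=\lfloor\alpha_0T/2\rfloor$ replications of each design, compute the sample standard deviations $S_{1,N_0},S_{2,N_0}$ (square roots of the sample variances with divisor $N_0-1$), and set $\hat p=S_{1,N_0}/(S_{1,N_0}+S_{2,N_0})$. Phase II: run $N_1=\lfloor(1-\alpha_0)\hat pT\rfloor+1$ additional new replications of design 1 and $N_2=\lfloor(1-\alpha_0)(1-\hat p)T\rfloor+1$ additional new replications of design 2. Let $\bar X_{i,N_i}$ be the sample mean of the $N_i$ phase-II replications of design $i$ only (phase-I samples are not reused). Output $\arg\max_{i\in\{1,2\}}\bar X_{i,N_i}$.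 The probability of false selection is $\mathrm{PFS}(T)=\mathbb{P}(\bar X_{1,N_1}<\bar X_{2,N_2})$. The objective on the right-hand side is taken to be $+\infty$ at $p=0$ and $p=1$. *)

theory Defs
  imports "HOL-Probability.Probability"
begin

text \<open>
  A sample path \<open>x :: nat \<Rightarrow> nat \<Rightarrow> real\<close> holds the outcome \<open>x i k\<close> of the \<open>k\<close>-th replication
  (counted from 0) of design \<open>i\<close>, for \<open>i \<in> {1, 2}\<close>; other values of \<open>i\<close> are never used.
\<close>

definition sample_mean :: "(nat \<Rightarrow> real) \<Rightarrow> nat set \<Rightarrow> real" where
  "sample_mean y A = (\<Sum>k\<in>A. y k) / real (card A)"

definition sample_sd :: "(nat \<Rightarrow> real) \<Rightarrow> nat \<Rightarrow> real" where
  "sample_sd y n = sqrt ((\<Sum>k<n. (y k - sample_mean y {..<n})\<^sup>2) / (real n - 1))"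

definition phase1_size :: "real \<Rightarrow> nat \<Rightarrow> nat" where
  "phase1_size \<alpha>0 T = nat \<lfloor>\<alpha>0 * real T / 2\<rfloor>"

text \<open>Both standard deviations vanish only on a null event once the phase-I size is at least 2;
  there the convention \<open>0 / 0 = 0\<close> applies.\<close>

definition p_hat :: "real \<Rightarrow> nat \<Rightarrow> (nat \<Rightarrow> nat \<Rightarrow> real) \<Rightarrow> real" where
  "p_hat \<alpha>0 T x =
     sample_sd (x 1) (phase1_size \<alpha>0 T) /
       (sample_sd (x 1) (phase1_size \<alpha>0 T) + sample_sd (x 2) (phase1_size \<alpha>0 T))"

definition phase2_size :: "real \<Rightarrow> nat \<Rightarrow> (nat \<Rightarrow> nat \<Rightarrow> real) \<Rightarrow> nat \<Rightarrow> nat" where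
  "phase2_size \<alpha>0 T x i =
     nat (\<lfloor>(1 - \<alpha>0) * (if i = 1 then p_hat \<alpha>0 T x else 1 - p_hat \<alpha>0 T x) * real T\<rfloor> + 1)"

text \<open>Phase II continues each design's stream where phase I stopped, so that its replications
  are new.\<close>

definition phase2_mean :: "real \<Rightarrow> nat \<Rightarrow> (nat \<Rightarrow> nat \<Rightarrow> real) \<Rightarrow> nat \<Rightarrow> real" where
  "phase2_mean \<alpha>0 T x i =
     sample_mean (x i)
       {phase1_size \<alpha>0 T ..< phase1_size \<alpha>0 T + phase2_size \<alpha>0 T x i}"

definition PFS :: "'a measure \<Rightarrow> (nat \<Rightarrow> nat \<Rightarrow> 'a \<Rightarrow> real) \<Rightarrow> real \<Rightarrow> nat \<Rightarrow> real" where
  "PFS M X \<alpha>0 T =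
     measure M {\<omega> \<in> space M.
       phase2_mean \<alpha>0 T (\<lambda>i k. X i k \<omega>) 1 < phase2_mean \<alpha>0 T (\<lambda>i k. X i k \<omega>) 2}"

definition rate_objective :: "real \<Rightarrow> real \<Rightarrow> real \<Rightarrow> real \<Rightarrow> real \<Rightarrow> ereal" where
  "rate_objective \<alpha>0 \<delta> \<sigma>1 \<sigma>2 p =
     (if p = 0 \<or> p = 1 then \<infinity>
      else ereal ((1 - \<alpha>0) * \<delta>\<^sup>2 / (2 * (\<sigma>1\<^sup>2 / p + \<sigma>2\<^sup>2 / (1 - p)))
        + \<alpha>0 / 2 * ln (((1 - p)\<^sup>2 * \<sigma>1\<^sup>2 + p\<^sup>2 * \<sigma>2\<^sup>2) / (2 * p * (1 - p) * \<sigma>1 * \<sigma>2))))"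

end

theory Submission
  imports Defs "HOL-Real_Asymp.Real_Asymp"
begin

text \<open>
  Let \<open>G q = (1 - \<alpha>0) \<delta>\<^sup>2 / (2 (\<sigma>1\<^sup>2 / q + \<sigma>2\<^sup>2 / (1 - q)))\<close> and let \<open>R q\<close> be the argument of the logarithm in
  the objective. The two summands of the objective are the exponential costs of two independent
  events: in phase I the estimated fraction \<open>p\<close> of the budget for design 1 lands near \<open>q\<close>, at cost
  \<open>\<alpha>0 / 2 * ln (R q)\<close>, and in phase II the order of the sample means is reversed under the allocation
  \<open>q\<close>, at cost \<open>G q\<close>. The cheapest combination dominates.

  Phase II. The allocation takes finitely many values and is determined by phase-I data, so the
  probability of false selection is a finite sum of products (\<open>prob_false_selection_decomp\<close>). For a
  fixed allocation the difference of the means is normal, and \<open>normal_prob_pos\<close> bounds its tail from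
  both sides. Since \<open>\<lfloor>x\<rfloor> + 1 > x\<close>, the upper bound is \<open>exp (- T * G q)\<close> without any error term.

  Phase I, upper bound. The event \<open>S1 \<le> r * S2\<close> compares two quadratic forms, and an exponential
  Markov inequality with the best parameter bounds its probability by \<open>2 / R ^ (n - 1)\<close>
  (\<open>prob_sq_dev_ratio_le\<close>). The Laplace transform of the sum of squares about the sample mean is
  computed without the chi-square distribution: its exponential is a Gaussian mixture, over centres
  \<open>c\<close>, of exponentials of sums of squares about \<open>c\<close>, and these factorise by independence.

  Phase I, lower bound. An exponential weight turns \<open>N(\<mu>, \<sigma>\<^sup>2)\<close> into \<open>N(\<mu>, s\<^sup>2)\<close>, for which a sample
  standard deviation near \<open>s\<close> is typical; on the typical event the weight is almost constant, so the
  original probability of that event is, to exponential order, the total weight divided by this constant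
  (\<open>prob_sample_sd_near_ge\<close>). Among all pairs \<open>(s1, s2)\<close> with \<open>s1 / (s1 + s2) = q\<close>, the choice in
  \<open>tilt_rate_sum\<close> is the cheapest, and its cost per replication pair is \<open>ln (R q)\<close>.

  For the upper bound the range of the estimated fraction is cut into finitely many cells on which
  \<open>G\<close> hardly varies (\<open>PFS_upper\<close>); for the lower bound a single small window around the minimiser
  suffices (\<open>PFS_lower\<close>).
\<close>

section \<open>Gaussian integrals and sums of squares\<close>

text \<open>
  An exponential quadratic weight turns one normal density into a multiple of another one. The
  quadratic coefficient is parametrised by the new standard deviation \<open>s\<close>, which may be larger or
  smaller than \<open>\<sigma>\<close>, so that no sign condition is needed to keep the result integrable.
\<close>
lemma normal_density_tilt:
  fixes \<mu> \<sigma> s h x :: real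
  assumes "\<sigma> > 0" "s > 0"
  shows "normal_density \<mu> \<sigma> x * exp (- ((1 / s\<^sup>2 - 1 / \<sigma>\<^sup>2) / 2 * (x - \<mu>)\<^sup>2) + h * (x - \<mu>))
       = s / \<sigma> * exp (h\<^sup>2 * s\<^sup>2 / 2) * normal_density (\<mu> + h * s\<^sup>2) s x"
proof -
  have exponent: "- (x - \<mu>)\<^sup>2 / (2 * \<sigma>\<^sup>2) + (- ((1 / s\<^sup>2 - 1 / \<sigma>\<^sup>2) / 2 * (x - \<mu>)\<^sup>2) + h * (x - \<mu>))
      = h\<^sup>2 * s\<^sup>2 / 2 + - (x - (\<mu> + h * s\<^sup>2))\<^sup>2 / (2 * s\<^sup>2)"
    using assms by (simp add: field_simps) (simp add: power2_eq_square power4_eq_xxxx algebra_simps)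
  have "1 / sqrt (2 * pi * \<sigma>\<^sup>2) = s / \<sigma> * (1 / sqrt (2 * pi * s\<^sup>2))"
    using assms by (simp add: real_sqrt_mult)
  then show ?thesis
    unfolding normal_density_def using exponent by (simp add: exp_add[symmetric] mult.assoc mult.left_commute)
qed

lemma nn_integral_normal_density:
  fixes m s :: real
  assumes "s > 0"
  shows "(\<integral>\<^sup>+x. ennreal (normal_density m s x) \<partial>lborel) = 1"
  using assms by (subst nn_integral_eq_integral) auto

lemma nn_integral_exp_square:
  fixes a m :: real
  assumes "a > 0"
  shows "(\<integral>\<^sup>+c. ennreal (exp (- (a * (c - m)\<^sup>2))) \<partial>lborel) = ennreal (sqrt (pi / a))"
proof -
  define s where "s = sqrt (1 / (2 * a))"
  have s: "s > 0" "s\<^sup>2 = 1 / (2 * a)" using assms by (auto simp: s_def)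
  have "exp (- (a * (c - m)\<^sup>2)) = sqrt (pi / a) * normal_density m s c" for c
    using assms by (simp add: normal_density_def s real_sqrt_divide)
  then have "(\<integral>\<^sup>+c. ennreal (exp (- (a * (c - m)\<^sup>2))) \<partial>lborel)
      = (\<integral>\<^sup>+c. ennreal (sqrt (pi / a)) * ennreal (normal_density m s c) \<partial>lborel)"
    using assms by (simp add: ennreal_mult)
  also have "\<dots> = ennreal (sqrt (pi / a))"
    by (subst nn_integral_cmult) (auto simp: nn_integral_normal_density s)
  finally show ?thesis .
qed

definition sq_dev :: "(nat \<Rightarrow> real) \<Rightarrow> nat \<Rightarrow> real" where
  "sq_dev y n = (\<Sum>k<n. (y k - sample_mean y {..<n})\<^sup>2)"

lemma sample_sd_eq: "sample_sd y n = sqrt (sq_dev y n / (real n - 1))"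
  by (simp add: sample_sd_def sq_dev_def)

lemma sq_dev_nonneg: "0 \<le> sq_dev y n"
  by (simp add: sq_dev_def sum_nonneg)

text \<open>
  The parallel axis identity. It shows that the sum of squares is smallest about the sample mean,
  and it makes the sum of squares about \<open>c\<close> a Gaussian exponent in \<open>c\<close>.
\<close>
lemma sum_square_shift:
  assumes "n > 0"
  shows "(\<Sum>k<n. (y k - c)\<^sup>2) = sq_dev y n + real n * (c - sample_mean y {..<n})\<^sup>2"
proof -
  define m where "m = sample_mean y {..<n}"
  have m: "(\<Sum>k<n. y k) = real n * m" using assms by (simp add: m_def sample_mean_def)
  have "(\<Sum>k<n. (y k - c)\<^sup>2) = (\<Sum>k<n. (y k - m)\<^sup>2 + (2 * (m - c) * y k + (c\<^sup>2 - m\<^sup>2)))"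
    by (rule sum.cong) (auto simp: power2_eq_square algebra_simps)
  also have "\<dots> = sq_dev y n + (2 * (m - c) * (\<Sum>k<n. y k) + real n * (c\<^sup>2 - m\<^sup>2))"
    by (simp add: sum.distrib sum_distrib_left[symmetric] sq_dev_def m_def)
  also have "\<dots> = sq_dev y n + real n * (c - m)\<^sup>2"
    unfolding m by (simp add: power2_eq_square algebra_simps)
  finally show ?thesis by (simp add: m_def)
qed

lemma sq_dev_le: "n > 0 \<Longrightarrow> sq_dev y n \<le> (\<Sum>k<n. (y k - c)\<^sup>2)"
  by (simp add: sum_square_shift)

text \<open>
  By the previous identity the integral over \<open>c\<close> only adds a Gaussian factor centred at the sample
  mean. The right-hand side involves sums of independent terms, whereas the deviations from the
  sample mean on the left are dependent.
\<close>
lemma exp_sq_dev_as_mixture: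
  assumes "n > 0" "l > 0"
  shows "ennreal (exp (- (l * sq_dev y n)))
    = ennreal (sqrt (real n * l / pi)) * (\<integral>\<^sup>+c. ennreal (exp (- (l * (\<Sum>k<n. (y k - c)\<^sup>2)))) \<partial>lborel)"
proof -
  define m where "m = sample_mean y {..<n}"
  have "(\<integral>\<^sup>+c. ennreal (exp (- (l * (\<Sum>k<n. (y k - c)\<^sup>2)))) \<partial>lborel)
      = (\<integral>\<^sup>+c. ennreal (exp (- (l * sq_dev y n))) * ennreal (exp (- (real n * l * (c - m)\<^sup>2))) \<partial>lborel)"
    using assms by (simp add: sum_square_shift ennreal_mult[symmetric] exp_add[symmetric] m_def algebra_simps)
  also have "\<dots> = ennreal (exp (- (l * sq_dev y n))) * ennreal (sqrt (pi / (real n * l)))"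
    using assms by (subst nn_integral_cmult) (auto simp: nn_integral_exp_square)
  finally show ?thesis using assms
    by (simp add: ennreal_mult[symmetric] real_sqrt_mult[symmetric] mult.left_commute)
qed

section \<open>Two independent streams of normal samples\<close>

locale gaussian_pair = prob_space M for M :: "'a measure" +
  fixes X :: "nat \<Rightarrow> nat \<Rightarrow> 'a \<Rightarrow> real" and \<mu> \<sigma> :: "nat \<Rightarrow> real"
  assumes indep: "indep_vars (\<lambda>_. borel) (\<lambda>(i, k). X i k) ({1, 2} \<times> UNIV)"
    and normal: "\<And>i k. i \<in> {1, 2} \<Longrightarrow> distributed M lborel (X i k) (normal_density (\<mu> i) (\<sigma> i))"
    and sigma_pos: "\<And>i. i \<in> {1, 2} \<Longrightarrow> \<sigma> i > 0"
begin

lemma X_measurable: "i \<in> {1, 2} \<Longrightarrow> X i k \<in> borel_measurable M"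
  using distributed_measurable[OF normal] by simp

lemma nn_integral_exp_sum:
  fixes g :: "nat \<Rightarrow> nat \<Rightarrow> real \<Rightarrow> real"
  assumes "finite J" "J \<subseteq> {1, 2} \<times> UNIV" "\<And>i k. g i k \<in> borel_measurable borel"
  shows "(\<integral>\<^sup>+\<omega>. ennreal (exp (\<Sum>(i, k)\<in>J. g i k (X i k \<omega>))) \<partial>M)
       = (\<Prod>(i, k)\<in>J. \<integral>\<^sup>+\<omega>. ennreal (exp (g i k (X i k \<omega>))) \<partial>M)"
proof -
  have ind: "indep_vars (\<lambda>_. borel) (\<lambda>p \<omega>. ennreal (exp (g (fst p) (snd p) ((\<lambda>(i, k). X i k) p \<omega>)))) J"
    by (rule indep_vars_compose2[OF indep_vars_subset[OF indep assms(2)],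
          where Y = "\<lambda>p x. ennreal (exp (g (fst p) (snd p) x))"]) (use assms(3) in measurable)
  have "(\<integral>\<^sup>+\<omega>. ennreal (exp (\<Sum>(i, k)\<in>J. g i k (X i k \<omega>))) \<partial>M)
     = (\<integral>\<^sup>+\<omega>. (\<Prod>p\<in>J. ennreal (exp (g (fst p) (snd p) ((\<lambda>(i, k). X i k) p \<omega>)))) \<partial>M)"
    using assms(1) by (intro nn_integral_cong) (simp add: exp_sum prod_ennreal case_prod_beta)
  also have "\<dots> = (\<Prod>p\<in>J. \<integral>\<^sup>+\<omega>. ennreal (exp (g (fst p) (snd p) ((\<lambda>(i, k). X i k) p \<omega>))) \<partial>M)"
    by (rule indep_vars_nn_integral[OF assms(1) ind]) auto
  finally show ?thesis by (simp add: case_prod_beta)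
qed

lemma nn_integral_exp_tilt:
  assumes "i \<in> {1, 2}" "s > 0"
  shows "(\<integral>\<^sup>+\<omega>. ennreal (exp (- ((1 / s\<^sup>2 - 1 / (\<sigma> i)\<^sup>2) / 2 * (X i k \<omega> - \<mu> i)\<^sup>2) + h * (X i k \<omega> - \<mu> i))) \<partial>M)
    = ennreal (s / \<sigma> i * exp (h\<^sup>2 * s\<^sup>2 / 2))"
proof -
  let ?g = "\<lambda>x. exp (- ((1 / s\<^sup>2 - 1 / (\<sigma> i)\<^sup>2) / 2 * (x - \<mu> i)\<^sup>2) + h * (x - \<mu> i))"
  have "(\<integral>\<^sup>+\<omega>. ennreal (?g (X i k \<omega>)) \<partial>M)
      = (\<integral>\<^sup>+x. ennreal (normal_density (\<mu> i) (\<sigma> i) x) * ennreal (?g x) \<partial>lborel)"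
    by (rule distributed_nn_integral[OF normal[OF assms(1)], symmetric]) measurable
  also have "\<dots> = (\<integral>\<^sup>+x. ennreal (s / \<sigma> i * exp (h\<^sup>2 * s\<^sup>2 / 2)) * ennreal (normal_density (\<mu> i + h * s\<^sup>2) s x) \<partial>lborel)"
    using sigma_pos[OF assms(1)] assms(2)
    by (intro nn_integral_cong)
       (simp only: ennreal_mult'[symmetric] normal_density_tilt normal_density_nonneg
          zero_le_mult_iff exp_ge_zero simp_thms zero_le_divide_iff less_imp_le)
  also have "\<dots> = ennreal (s / \<sigma> i * exp (h\<^sup>2 * s\<^sup>2 / 2))"
    using assms(2) by (subst nn_integral_cmult) (auto simp: nn_integral_normal_density)
  finally show ?thesis .
qed

text \<open>
  For a centre other than the mean, completing the square leaves a Gaussian function of the centre,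
  ready to be integrated once more.
\<close>
lemma nn_integral_exp_square_about:
  assumes "i \<in> {1, 2}" "s > 0" and l: "l = (1 / s\<^sup>2 - 1 / (\<sigma> i)\<^sup>2) / 2"
  shows "(\<integral>\<^sup>+\<omega>. ennreal (exp (- (l * (X i k \<omega> - c)\<^sup>2))) \<partial>M)
    = ennreal (s / \<sigma> i * exp (- (l * s\<^sup>2 / (\<sigma> i)\<^sup>2 * (c - \<mu> i)\<^sup>2)))"
proof -
  have sp: "\<sigma> i > 0" using sigma_pos assms by auto
  define d where "d = c - \<mu> i"
  have sq: "- (l * (x - c)\<^sup>2) = - (l * d\<^sup>2) + (- (l * (x - \<mu> i)\<^sup>2) + 2 * l * d * (x - \<mu> i))" for x
    unfolding d_def by (simp add: power2_eq_square algebra_simps)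
  have e: "- (l * d\<^sup>2) + (2 * l * d)\<^sup>2 * s\<^sup>2 / 2 = - (l * s\<^sup>2 / (\<sigma> i)\<^sup>2 * d\<^sup>2)"
  proof -
    have "2 * l * s\<^sup>2 = 1 - s\<^sup>2 / (\<sigma> i)\<^sup>2" unfolding l using assms(2) sp by (simp add: field_simps)
    moreover have "(2 * l * d)\<^sup>2 * s\<^sup>2 / 2 = l * d\<^sup>2 * (2 * l * s\<^sup>2)"
      by (simp add: power2_eq_square)
    ultimately have "(2 * l * d)\<^sup>2 * s\<^sup>2 / 2 = l * d\<^sup>2 * (1 - s\<^sup>2 / (\<sigma> i)\<^sup>2)" by (simp only:)
    then show ?thesis by (simp add: algebra_simps)
  qed
  have tilt: "(\<integral>\<^sup>+\<omega>. ennreal (exp (- (l * (X i k \<omega> - \<mu> i)\<^sup>2) + 2 * l * d * (X i k \<omega> - \<mu> i))) \<partial>M)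
      = ennreal (s / \<sigma> i * exp ((2 * l * d)\<^sup>2 * s\<^sup>2 / 2))"
    unfolding l by (rule nn_integral_exp_tilt[OF assms(1,2)])
  have "(\<integral>\<^sup>+\<omega>. ennreal (exp (- (l * (X i k \<omega> - c)\<^sup>2))) \<partial>M)
     = (\<integral>\<^sup>+\<omega>. ennreal (exp (- (l * d\<^sup>2))) * ennreal (exp (- (l * (X i k \<omega> - \<mu> i)\<^sup>2) + 2 * l * d * (X i k \<omega> - \<mu> i))) \<partial>M)"
    unfolding sq exp_add[of "- (l * d\<^sup>2)"] by (simp add: ennreal_mult')
  also have "\<dots> = ennreal (exp (- (l * d\<^sup>2))) * ennreal (s / \<sigma> i * exp ((2 * l * d)\<^sup>2 * s\<^sup>2 / 2))"
    unfolding tilt[symmetric] using X_measurable[OF assms(1)] by (subst nn_integral_cmult) auto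
  also have "\<dots> = ennreal (s / \<sigma> i * exp (- (l * d\<^sup>2) + (2 * l * d)\<^sup>2 * s\<^sup>2 / 2))"
    unfolding exp_add[of "- (l * d\<^sup>2)"] using assms(2) sp
    by (simp add: ennreal_mult'[symmetric])
  finally show ?thesis unfolding e by (simp add: d_def)
qed

lemma sq_dev_measurable: "i \<in> {1, 2} \<Longrightarrow> (\<lambda>\<omega>. sq_dev (\<lambda>k. X i k \<omega>) n) \<in> borel_measurable M"
  unfolding sq_dev_def sample_mean_def using X_measurable by measurable


subsection \<open>Upper bound for the ratio of the sample deviations\<close>

text \<open>
  Markov's inequality for the expectation of \<open>exp (- l Q + l r\<^sup>2 Q')\<close>, where \<open>Q\<close> and \<open>Q'\<close> are the sums of
  squares of designs \<open>i\<close> and \<open>j\<close> about their sample means. For \<open>Q\<close> the mixture representation is used,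
  which costs one factor and explains the power \<open>n - 1\<close>. For \<open>Q'\<close>, which has the positive sign, it is
  enough to enlarge it to the sum of squares about the true mean; this only affects the constant \<open>2\<close>.
\<close>
lemma prob_sq_dev_ratio_le:
  assumes ij: "i \<in> {1, 2}" "j \<in> {1, 2}" "i \<noteq> j" and "n > 0" "r > 0" and r: "r * \<sigma> j \<le> \<sigma> i"
  shows "prob {\<omega> \<in> space M. sq_dev (\<lambda>k. X i k \<omega>) n \<le> r\<^sup>2 * sq_dev (\<lambda>k. X j k \<omega>) n}
       \<le> 2 / (((\<sigma> i)\<^sup>2 + r\<^sup>2 * (\<sigma> j)\<^sup>2) / (2 * r * \<sigma> i * \<sigma> j)) ^ (n - 1)"
proof (cases "r * \<sigma> j = \<sigma> i")
  case True
  have "\<sigma> i > 0" "\<sigma> j > 0" using sigma_pos ij by auto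
  then have R: "((\<sigma> i)\<^sup>2 + r\<^sup>2 * (\<sigma> j)\<^sup>2) / (2 * r * \<sigma> i * \<sigma> j) = 1"
    using \<open>r > 0\<close> unfolding True[symmetric] by (simp add: field_simps power2_eq_square)
  show ?thesis unfolding R by (rule order_trans[OF prob_le_1]) simp
next
  case False
  have sp: "\<sigma> i > 0" "\<sigma> j > 0" using sigma_pos ij by auto
  define a b where "a = (\<sigma> i)\<^sup>2" and "b = r\<^sup>2 * (\<sigma> j)\<^sup>2"
  have ab: "a > 0" "b > 0" "b < a"
    using sp \<open>r > 0\<close> r False by (auto simp: a_def b_def power_mult_distrib[symmetric] intro!: power_strict_mono)
  \<comment> \<open>This \<open>l\<close> maximises \<open>(1 + 2 l a) (1 - 2 l b)\<close>, hence makes the bound smallest to exponential order. Under the resulting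
    tilt the two standard deviations are \<open>s\<close> and \<open>s / r\<close>, so that their ratio is exactly \<open>r\<close>.\<close>
  define l where "l = (a - b) / (4 * a * b)"
  have l: "l > 0" using ab by (simp add: l_def)
  define s where "s = sqrt (2 * a * b / (a + b))"
  have s: "s > 0" "s\<^sup>2 = 2 * a * b / (a + b)" using ab by (auto simp: s_def)
  have li: "l = (1 / s\<^sup>2 - 1 / (\<sigma> i)\<^sup>2) / 2"
    unfolding s l_def a_def[symmetric] using ab by (simp add: field_simps power2_eq_square)
  have lj: "- (l * r\<^sup>2) = (1 / (s / r)\<^sup>2 - 1 / (\<sigma> j)\<^sup>2) / 2"
  proof -
    have inv: "1 / (\<sigma> j)\<^sup>2 = r\<^sup>2 / b" using \<open>r > 0\<close> sp by (simp add: b_def)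
    show ?thesis unfolding inv power_divide s l_def using ab \<open>r > 0\<close> by (simp add: field_simps power2_eq_square)
  qed
  define K where "K = sqrt (real n * l / pi)"
  define g where "g c p k x = (if p = i then - (l * (x - c)\<^sup>2) else l * r\<^sup>2 * (x - \<mu> j)\<^sup>2)" for c x :: real and p k :: nat
  have [measurable]: "X i k \<in> borel_measurable M" "X j k \<in> borel_measurable M" for k
    using X_measurable ij by auto
  have [measurable]: "(\<lambda>\<omega>. sq_dev (\<lambda>k. X i k \<omega>) n) \<in> borel_measurable M"
      "(\<lambda>\<omega>. sq_dev (\<lambda>k. X j k \<omega>) n) \<in> borel_measurable M"
    using sq_dev_measurable ij by auto
  define f where "f \<omega> c = ennreal (exp (- (l * (\<Sum>k<n. (X i k \<omega> - c)\<^sup>2)) + l * r\<^sup>2 * (\<Sum>k<n. (X j k \<omega> - \<mu> j)\<^sup>2)))" for \<omega> c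
  have fm: "case_prod f \<in> borel_measurable (M \<Otimes>\<^sub>M lborel)" unfolding f_def by measurable
  have fm2 [measurable]: "f \<omega> \<in> borel_measurable lborel" for \<omega> unfolding f_def by measurable
  interpret pair_sigma_finite M lborel ..
  have inner: "(\<integral>\<^sup>+\<omega>. f \<omega> c \<partial>M)
     = ennreal ((s / \<sigma> i) ^ n * (s / r / \<sigma> j) ^ n) * ennreal (exp (- (real n * l * s\<^sup>2 / (\<sigma> i)\<^sup>2 * (c - \<mu> i)\<^sup>2)))" for c
  proof -
    have split: "(\<Sum>(p, k)\<in>{i, j} \<times> {..<n}. h p k) = (\<Sum>k<n. h i k) + (\<Sum>k<n. h j k)" for h :: "nat \<Rightarrow> nat \<Rightarrow> real"
      using ij by (simp add: sum.cartesian_product[symmetric])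
    have split': "(\<Prod>(p, k)\<in>{i, j} \<times> {..<n}. h p k) = (\<Prod>k<n. h i k) * (\<Prod>k<n. h j k)" for h :: "nat \<Rightarrow> nat \<Rightarrow> ennreal"
      using ij by (simp add: prod.cartesian_product[symmetric])
    have "(\<integral>\<^sup>+\<omega>. f \<omega> c \<partial>M) = (\<integral>\<^sup>+\<omega>. ennreal (exp (\<Sum>(p, k)\<in>{i, j} \<times> {..<n}. g c p k (X p k \<omega>))) \<partial>M)"
      unfolding split f_def using ij by (simp add: g_def sum_distrib_left sum_negf)
    also have "\<dots> = (\<Prod>(p, k)\<in>{i, j} \<times> {..<n}. \<integral>\<^sup>+\<omega>. ennreal (exp (g c p k (X p k \<omega>))) \<partial>M)"
      using ij by (intro nn_integral_exp_sum) (auto simp: g_def)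
    also have "\<dots> = ennreal (s / \<sigma> i * exp (- (l * s\<^sup>2 / (\<sigma> i)\<^sup>2 * (c - \<mu> i)\<^sup>2))) ^ n * ennreal (s / r / \<sigma> j) ^ n"
      unfolding split'
      using ij nn_integral_exp_square_about[OF ij(1) s(1) li] nn_integral_exp_square_about[OF ij(2) _ lj, of _ "\<mu> j"] s(1) \<open>r > 0\<close>
      by (simp add: g_def)
    also have "\<dots> = ennreal ((s / \<sigma> i) ^ n * (s / r / \<sigma> j) ^ n) * ennreal (exp (- (real n * l * s\<^sup>2 / (\<sigma> i)\<^sup>2 * (c - \<mu> i)\<^sup>2)))"
    proof -
      have "exp (- (real n * l * s\<^sup>2 / (\<sigma> i)\<^sup>2 * (c - \<mu> i)\<^sup>2)) = exp (- (l * s\<^sup>2 / (\<sigma> i)\<^sup>2 * (c - \<mu> i)\<^sup>2)) ^ n"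
        by (simp add: exp_of_nat_mult[symmetric] mult.assoc)
      then show ?thesis
        using sp s(1) \<open>r > 0\<close>
        by (simp add: ennreal_power ennreal_mult'[symmetric] power_mult_distrib power_divide)
    qed
    finally show ?thesis .
  qed
  have "emeasure M {\<omega> \<in> space M. sq_dev (\<lambda>k. X i k \<omega>) n \<le> r\<^sup>2 * sq_dev (\<lambda>k. X j k \<omega>) n}
      = (\<integral>\<^sup>+\<omega>. indicator {\<omega> \<in> space M. sq_dev (\<lambda>k. X i k \<omega>) n \<le> r\<^sup>2 * sq_dev (\<lambda>k. X j k \<omega>) n} \<omega> \<partial>M)"
    by (rule nn_integral_indicator[symmetric]) measurable
  also have "\<dots> \<le> (\<integral>\<^sup>+\<omega>. ennreal K * (\<integral>\<^sup>+c. f \<omega> c \<partial>lborel) \<partial>M)"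
  proof (rule nn_integral_mono)
    fix \<omega> assume "\<omega> \<in> space M"
    let ?Q = "sq_dev (\<lambda>k. X i k \<omega>) n" and ?Q' = "sq_dev (\<lambda>k. X j k \<omega>) n" and ?W = "\<Sum>k<n. (X j k \<omega> - \<mu> j)\<^sup>2"
    have "indicator {\<omega> \<in> space M. sq_dev (\<lambda>k. X i k \<omega>) n \<le> r\<^sup>2 * sq_dev (\<lambda>k. X j k \<omega>) n} \<omega>
        \<le> ennreal (exp (- (l * ?Q))) * ennreal (exp (l * r\<^sup>2 * ?W))"
    proof (cases "?Q \<le> r\<^sup>2 * ?Q'")
      case True
      also have "r\<^sup>2 * ?Q' \<le> r\<^sup>2 * ?W" using sq_dev_le[OF \<open>n > 0\<close>] by (intro mult_left_mono) auto
      finally have "l * ?Q \<le> l * (r\<^sup>2 * ?W)" using l by (intro mult_left_mono) auto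
      then have "1 \<le> exp (- (l * ?Q)) * exp (l * r\<^sup>2 * ?W)"
        by (simp add: exp_add[symmetric] mult.assoc)
      then have "(1::ennreal) \<le> ennreal (exp (- (l * ?Q)) * exp (l * r\<^sup>2 * ?W))"
        by (simp only: ennreal_ge_1)
      then show ?thesis by (auto simp: indicator_def ennreal_mult)
    qed auto
    also have "\<dots> = ennreal K * (\<integral>\<^sup>+c. f \<omega> c \<partial>lborel)"
      unfolding exp_sq_dev_as_mixture[OF \<open>n > 0\<close> l] f_def exp_add K_def
      by (simp add: ennreal_mult nn_integral_multc mult.assoc)
    finally show "indicator {\<omega> \<in> space M. sq_dev (\<lambda>k. X i k \<omega>) n \<le> r\<^sup>2 * sq_dev (\<lambda>k. X j k \<omega>) n} \<omega>
        \<le> ennreal K * (\<integral>\<^sup>+c. f \<omega> c \<partial>lborel)" .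
  qed
  also have "\<dots> = ennreal K * (\<integral>\<^sup>+\<omega>. (\<integral>\<^sup>+c. f \<omega> c \<partial>lborel) \<partial>M)"
    using lborel.borel_measurable_nn_integral[OF fm] by (intro nn_integral_cmult) simp
  also have "(\<integral>\<^sup>+\<omega>. (\<integral>\<^sup>+c. f \<omega> c \<partial>lborel) \<partial>M) = (\<integral>\<^sup>+c. (\<integral>\<^sup>+\<omega>. f \<omega> c \<partial>M) \<partial>lborel)"
    using Fubini'[OF fm] by simp
  also have "\<dots> = ennreal ((s / \<sigma> i) ^ n * (s / r / \<sigma> j) ^ n) * ennreal (sqrt (pi / (real n * l * s\<^sup>2 / (\<sigma> i)\<^sup>2)))"
  proof -
    have "real n * l * s\<^sup>2 / (\<sigma> i)\<^sup>2 > 0" using l s(1) sp \<open>n > 0\<close> by simp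
    then show ?thesis
      unfolding inner nn_integral_exp_square[OF \<open>real n * l * s\<^sup>2 / (\<sigma> i)\<^sup>2 > 0\<close>, of "\<mu> i", symmetric]
      by (intro nn_integral_cmult) simp
  qed
  also have "ennreal K * \<dots> = ennreal ((s / \<sigma> i * (s / r / \<sigma> j)) ^ n * (\<sigma> i / s))"
  proof -
    have "K * sqrt (pi / (real n * l * s\<^sup>2 / (\<sigma> i)\<^sup>2)) = sqrt ((\<sigma> i / s)\<^sup>2)"
      unfolding K_def real_sqrt_mult[symmetric] using l \<open>n > 0\<close> s(1) sp by (simp add: field_simps)
    then have "K * sqrt (pi / (real n * l * s\<^sup>2 / (\<sigma> i)\<^sup>2)) = \<sigma> i / s" using s(1) sp by simp
    then have "K * (((s / \<sigma> i) ^ n * (s / r / \<sigma> j) ^ n) * sqrt (pi / (real n * l * s\<^sup>2 / (\<sigma> i)\<^sup>2)))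
       = (s / \<sigma> i * (s / r / \<sigma> j)) ^ n * (\<sigma> i / s)"
      by (simp only: mult.left_commute[of K] power_mult_distrib)
    moreover have "K \<ge> 0" unfolding K_def using l by auto
    ultimately show ?thesis using s(1) sp l \<open>r > 0\<close> by (simp add: ennreal_mult'[symmetric] mult.assoc)
  qed
  also have "(s / \<sigma> i * (s / r / \<sigma> j)) ^ n * (\<sigma> i / s) = (s / \<sigma> i * (s / r / \<sigma> j)) ^ (n - 1) * (s / r / \<sigma> j)"
    using \<open>n > 0\<close> s(1) sp by (cases n) auto
  finally have le: "prob {\<omega> \<in> space M. sq_dev (\<lambda>k. X i k \<omega>) n \<le> r\<^sup>2 * sq_dev (\<lambda>k. X j k \<omega>) n}
      \<le> (s / \<sigma> i * (s / r / \<sigma> j)) ^ (n - 1) * (s / r / \<sigma> j)"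
    using s(1) sp \<open>r > 0\<close> by (simp add: emeasure_eq_measure)
  define R where "R = ((\<sigma> i)\<^sup>2 + r\<^sup>2 * (\<sigma> j)\<^sup>2) / (2 * r * \<sigma> i * \<sigma> j)"
  have R: "R > 0" unfolding R_def using sp \<open>r > 0\<close> by (intro divide_pos_pos add_pos_pos) auto
  have "s / \<sigma> i * (s / r / \<sigma> j) = s\<^sup>2 / (r * \<sigma> i * \<sigma> j)" by (simp add: power2_eq_square)
  also have "\<dots> = 1 / R"
  proof -
    define t where "t = r * \<sigma> i * \<sigma> j"
    have t: "t > 0" "a * b = t * t" using sp \<open>r > 0\<close> by (auto simp: t_def a_def b_def power2_eq_square)
    have R_t: "R = (a + b) / (2 * t)" by (simp add: R_def a_def b_def t_def mult.assoc)
    have "s\<^sup>2 / t = 2 * (t * t) / (a + b) / t" unfolding s t(2)[symmetric] by simp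
    then show ?thesis unfolding t_def[symmetric] R_t using t(1) ab by simp
  qed
  finally have base: "s / \<sigma> i * (s / r / \<sigma> j) = 1 / R" .
  have "s / r / \<sigma> j \<le> 2"
  proof (rule power2_le_imp_le)
    have "(s / r / \<sigma> j)\<^sup>2 = s\<^sup>2 / b" by (simp add: b_def power_divide power_mult_distrib)
    also have "s\<^sup>2 \<le> 2 * b" unfolding s using ab by (simp add: divide_le_eq mult_left_mono)
    then have "s\<^sup>2 / b \<le> 2\<^sup>2" using ab by (simp add: divide_le_eq)
    finally show "(s / r / \<sigma> j)\<^sup>2 \<le> 2\<^sup>2" .
  qed auto
  then have "(s / \<sigma> i * (s / r / \<sigma> j)) ^ (n - 1) * (s / r / \<sigma> j) \<le> (1 / R) ^ (n - 1) * 2"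
    unfolding base using R by (intro mult_left_mono) auto
  with le show ?thesis unfolding R_def[symmetric] by (simp add: power_divide)
qed

end

subsection \<open>Lower bound for a prescribed sample deviation\<close>

text \<open>
  The relative entropy of \<open>N(\<mu>, s\<^sup>2)\<close> with respect to \<open>N(\<mu>, \<tau>\<^sup>2)\<close>.
\<close>
definition tilt_rate :: "real \<Rightarrow> real \<Rightarrow> real" where
  "tilt_rate \<tau> s = (s\<^sup>2 / \<tau>\<^sup>2 - 1) / 2 - ln (s / \<tau>)"

context gaussian_pair
begin

lemma nn_integral_exp_sum_design:
  assumes "i \<in> {1, 2}" "g \<in> borel_measurable borel"
  shows "(\<integral>\<^sup>+\<omega>. ennreal (exp (\<Sum>k<n. g (X i k \<omega>))) \<partial>M) = (\<Prod>k<n. \<integral>\<^sup>+\<omega>. ennreal (exp (g (X i k \<omega>))) \<partial>M)"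
proof -
  have "{i} \<times> {..<n} \<subseteq> {1, 2} \<times> UNIV" using assms by auto
  then show ?thesis
    using nn_integral_exp_sum[of "{i} \<times> {..<n}" "\<lambda>_ _. g"] assms
    by (simp add: sum.cartesian_product[symmetric] prod.cartesian_product[symmetric])
qed

text \<open>
  A Chernoff bound for the measure with weight \<open>exp (\<Sum>k<n. w (X i k))\<close>. The weight is not normalised,
  so the bound has to be compared with the total weight.
\<close>
lemma tilted_chernoff:
  fixes w \<phi> :: "real \<Rightarrow> real" and b c :: real
  assumes i: "i \<in> {1, 2}" and [measurable]: "w \<in> borel_measurable borel" "\<phi> \<in> borel_measurable borel" and "c \<ge> 0"
    and c: "\<And>k. (\<integral>\<^sup>+\<omega>. ennreal (exp (w (X i k \<omega>) + \<phi> (X i k \<omega>))) \<partial>M) = ennreal c"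
  shows "(\<integral>\<^sup>+\<omega>. ennreal (exp (\<Sum>k<n. w (X i k \<omega>))) * indicator {\<omega>. real n * b \<le> (\<Sum>k<n. \<phi> (X i k \<omega>))} \<omega> \<partial>M)
     \<le> ennreal ((c * exp (- b)) ^ n)"
proof -
  have [measurable]: "X i k \<in> borel_measurable M" for k using X_measurable i by auto
  have "(\<integral>\<^sup>+\<omega>. ennreal (exp (\<Sum>k<n. w (X i k \<omega>))) * indicator {\<omega>. real n * b \<le> (\<Sum>k<n. \<phi> (X i k \<omega>))} \<omega> \<partial>M)
      \<le> (\<integral>\<^sup>+\<omega>. ennreal (exp (- b) ^ n) * ennreal (exp (\<Sum>k<n. w (X i k \<omega>) + \<phi> (X i k \<omega>))) \<partial>M)"
  proof (rule nn_integral_mono)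
    fix \<omega>
    show "ennreal (exp (\<Sum>k<n. w (X i k \<omega>))) * indicator {\<omega>. real n * b \<le> (\<Sum>k<n. \<phi> (X i k \<omega>))} \<omega>
      \<le> ennreal (exp (- b) ^ n) * ennreal (exp (\<Sum>k<n. w (X i k \<omega>) + \<phi> (X i k \<omega>)))"
      by (auto simp: indicator_def exp_of_nat_mult[symmetric] ennreal_mult'[symmetric] exp_add[symmetric] sum.distrib
          intro!: ennreal_leI)
  qed
  also have "\<dots> = ennreal (exp (- b) ^ n) * ennreal c ^ n"
    using nn_integral_exp_sum_design[OF i, of "\<lambda>x. w x + \<phi> x"]
    by (subst nn_integral_cmult) (auto simp: c)
  also have "\<dots> = ennreal ((c * exp (- b)) ^ n)"
    using \<open>c \<ge> 0\<close> by (simp add: ennreal_power ennreal_mult'[symmetric] power_mult_distrib mult.commute)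
  finally show ?thesis .
qed

text \<open>
  Both signs of \<open>u\<close> are used: \<open>u > 0\<close> controls the upper tail of the sum of squares and \<open>u < 0\<close> the
  lower tail. The parameter is scaled so that the tilted standard deviation becomes
  \<open>s / sqrt (1 - u)\<close>.
\<close>
lemma tilted_quadratic_tail:
  fixes u t :: real
  assumes i: "i \<in> {1, 2}" and s: "s > 0" and u: "u < 1"
    and l: "l = (1 / s\<^sup>2 - 1 / (\<sigma> i)\<^sup>2) / 2"
  shows "(\<integral>\<^sup>+\<omega>. ennreal (exp (\<Sum>k<n. - (l * (X i k \<omega> - \<mu> i)\<^sup>2)))
        * indicator {\<omega>. real n * (u * t * s\<^sup>2) \<le> u * (\<Sum>k<n. (X i k \<omega> - \<mu> i)\<^sup>2)} \<omega> \<partial>M)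
     \<le> ennreal ((s / \<sigma> i * (exp (- (u * t / 2)) / sqrt (1 - u))) ^ n)"
proof -
  have sp: "\<sigma> i > 0" using sigma_pos i by auto
  define s' where "s' = s / sqrt (1 - u)"
  have s': "s' > 0" "s'\<^sup>2 = s\<^sup>2 / (1 - u)" using s u by (auto simp: s'_def power_divide)
  define h where "h = u / (2 * s\<^sup>2)"
  have e: "- (l * y\<^sup>2) + h * y\<^sup>2 = - ((1 / s'\<^sup>2 - 1 / (\<sigma> i)\<^sup>2) / 2 * (y)\<^sup>2) + 0 * y" for y
    unfolding l s' h_def using s sp u by (simp add: field_simps)
  have "(\<integral>\<^sup>+\<omega>. ennreal (exp (\<Sum>k<n. - (l * (X i k \<omega> - \<mu> i)\<^sup>2)))
        * indicator {\<omega>. real n * (u * t / 2) \<le> (\<Sum>k<n. h * (X i k \<omega> - \<mu> i)\<^sup>2)} \<omega> \<partial>M)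
     \<le> ennreal ((s' / \<sigma> i * exp (- (u * t / 2))) ^ n)"
  proof (rule tilted_chernoff[OF i, where w = "\<lambda>x. - (l * (x - \<mu> i)\<^sup>2)" and \<phi> = "\<lambda>x. h * (x - \<mu> i)\<^sup>2"])
    show "(\<integral>\<^sup>+\<omega>. ennreal (exp (- (l * (X i k \<omega> - \<mu> i)\<^sup>2) + h * (X i k \<omega> - \<mu> i)\<^sup>2)) \<partial>M) = ennreal (s' / \<sigma> i)" for k
      unfolding e nn_integral_exp_tilt[OF i s'(1)] by simp
    show "0 \<le> s' / \<sigma> i" using s' sp by simp
  qed measurable
  also have "s' / \<sigma> i * exp (- (u * t / 2)) = s / \<sigma> i * (exp (- (u * t / 2)) / sqrt (1 - u))"
    by (simp add: s'_def)
  also have "{\<omega>. real n * (u * t / 2) \<le> (\<Sum>k<n. h * (X i k \<omega> - \<mu> i)\<^sup>2)}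
     = {\<omega>. real n * (u * t * s\<^sup>2) \<le> u * (\<Sum>k<n. (X i k \<omega> - \<mu> i)\<^sup>2)}"
    unfolding sum_distrib_left[symmetric] h_def using s by (simp add: field_simps)
  finally show ?thesis .
qed

lemma tilted_linear_tail:
  fixes h :: real
  assumes i: "i \<in> {1, 2}" and s: "s > 0"
    and l: "l = (1 / s\<^sup>2 - 1 / (\<sigma> i)\<^sup>2) / 2"
  shows "(\<integral>\<^sup>+\<omega>. ennreal (exp (\<Sum>k<n. - (l * (X i k \<omega> - \<mu> i)\<^sup>2)))
        * indicator {\<omega>. real n * (h\<^sup>2 * s\<^sup>2) \<le> h * (\<Sum>k<n. X i k \<omega> - \<mu> i)} \<omega> \<partial>M)
     \<le> ennreal ((s / \<sigma> i * exp (- (h\<^sup>2 * s\<^sup>2 / 2))) ^ n)"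
proof -
  have sp: "\<sigma> i > 0" using sigma_pos i by auto
  have "(\<integral>\<^sup>+\<omega>. ennreal (exp (\<Sum>k<n. - (l * (X i k \<omega> - \<mu> i)\<^sup>2)))
        * indicator {\<omega>. real n * (h\<^sup>2 * s\<^sup>2) \<le> (\<Sum>k<n. h * (X i k \<omega> - \<mu> i))} \<omega> \<partial>M)
     \<le> ennreal ((s / \<sigma> i * exp (h\<^sup>2 * s\<^sup>2 / 2) * exp (- (h\<^sup>2 * s\<^sup>2))) ^ n)"
  proof (rule tilted_chernoff[OF i, where w = "\<lambda>x. - (l * (x - \<mu> i)\<^sup>2)" and \<phi> = "\<lambda>x. h * (x - \<mu> i)"])
    show "(\<integral>\<^sup>+\<omega>. ennreal (exp (- (l * (X i k \<omega> - \<mu> i)\<^sup>2) + h * (X i k \<omega> - \<mu> i))) \<partial>M)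
        = ennreal (s / \<sigma> i * exp (h\<^sup>2 * s\<^sup>2 / 2))" for k
      unfolding l by (rule nn_integral_exp_tilt[OF i s])
    show "0 \<le> s / \<sigma> i * exp (h\<^sup>2 * s\<^sup>2 / 2)" using s sp by simp
  qed measurable
  also have "s / \<sigma> i * exp (h\<^sup>2 * s\<^sup>2 / 2) * exp (- (h\<^sup>2 * s\<^sup>2)) = s / \<sigma> i * exp (- (h\<^sup>2 * s\<^sup>2 / 2))"
    by (simp add: mult.assoc exp_add[symmetric])
  finally show ?thesis by (simp only: sum_distrib_left)
qed

text \<open>
  The sum of the deviations is controlled as well, because the sum of squares about the true mean
  determines the sample variance only once the sample mean is known to be close to the true mean.
\<close>
definition typical :: "nat \<Rightarrow> real \<Rightarrow> real \<Rightarrow> nat \<Rightarrow> 'a set" where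
  "typical i s \<kappa> n = {\<omega> \<in> space M.
     real n * ((1 - \<kappa>) * s\<^sup>2) < (\<Sum>k<n. (X i k \<omega> - \<mu> i)\<^sup>2) \<and>
     (\<Sum>k<n. (X i k \<omega> - \<mu> i)\<^sup>2) < real n * ((1 + \<kappa>) * s\<^sup>2) \<and>
     \<bar>\<Sum>k<n. X i k \<omega> - \<mu> i\<bar> < real n * \<kappa>}"

lemma typical_measurable: "i \<in> {1, 2} \<Longrightarrow> typical i s \<kappa> n \<in> events"
  unfolding typical_def using X_measurable by measurable

text \<open>
  The total weight is \<open>(s / \<sigma> i) ^ n\<close>. Each of the four ways of being atypical carries an exponentially
  small part of it.
\<close>
lemma tilted_atypical_le:
  assumes i: "i \<in> {1, 2}" and s: "s > 0" and \<kappa>: "\<kappa> > 0"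
    and l: "l = (1 / s\<^sup>2 - 1 / (\<sigma> i)\<^sup>2) / 2"
  shows "\<exists>\<rho>. 0 \<le> \<rho> \<and> \<rho> < 1 \<and> (\<forall>n.
    (\<integral>\<^sup>+\<omega>. ennreal (exp (\<Sum>k<n. - (l * (X i k \<omega> - \<mu> i)\<^sup>2))) * indicator (space M - typical i s \<kappa> n) \<omega> \<partial>M)
       \<le> ennreal ((s / \<sigma> i) ^ n * (4 * \<rho> ^ n)))"
proof -
  have sp: "\<sigma> i > 0" using sigma_pos i by auto
  have [measurable]: "X i k \<in> borel_measurable M" for k using X_measurable i by auto
  \<comment> \<open>The upper tail needs \<open>(1 - u) exp (u (1 + \<kappa>)) > 1\<close>. Bounding \<open>exp x\<close> below by \<open>1 + x\<close> reduces this
    to \<open>u (1 + \<kappa>) < \<kappa>\<close>. For the lower tail the choice \<open>u = - \<kappa>\<close> works in the same way.\<close>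
  define u where "u = \<kappa> / (2 * (1 + \<kappa>))"
  have u: "0 < u" "u < 1" "u * (1 + \<kappa>) = \<kappa> / 2" using \<kappa> by (auto simp: u_def field_simps)
  define \<rho>1 \<rho>2 \<rho>3 where "\<rho>1 = exp (- (u * (1 + \<kappa>) / 2)) / sqrt (1 - u)"
    and "\<rho>2 = exp (- (- \<kappa> * (1 - \<kappa>) / 2)) / sqrt (1 - - \<kappa>)"
    and "\<rho>3 = exp (- (\<kappa>\<^sup>2 / s\<^sup>2 / 2))"
  have half: "exp (- (x / 2)) = sqrt (exp (- x))" for x :: real
    by (rule real_sqrt_unique[symmetric]) (auto simp: power2_eq_square exp_add[symmetric])
  have flip: "exp (- x) < c" if "1 < c * exp x" for c x :: real
    using that by (simp add: exp_minus inverse_eq_divide divide_less_eq)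
  have r1: "\<rho>1 < 1"
  proof -
    have "1 < (1 - u) * (1 + u * (1 + \<kappa>))"
    proof -
      have "(1 - u) * (1 + u * (1 + \<kappa>)) = 1 + u * \<kappa> - u * (u * (1 + \<kappa>))" by (simp add: algebra_simps)
      moreover have "u * (u * (1 + \<kappa>)) = u * \<kappa> / 2" by (simp only: u(3))
      moreover have "u * \<kappa> > 0" using u \<kappa> by simp
      ultimately show ?thesis by linarith
    qed
    also have "\<dots> \<le> (1 - u) * exp (u * (1 + \<kappa>))" using u exp_ge_add_one_self by (intro mult_left_mono) auto
    finally have "exp (- (u * (1 + \<kappa>))) < 1 - u" by (rule flip)
    then show ?thesis unfolding \<rho>1_def half using u(1,2) by simp
  qed
  have r2: "\<rho>2 < 1"
  proof -
    have "1 < (1 + \<kappa>) * (1 + - \<kappa> * (1 - \<kappa>))"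
    proof -
      have "(1 + \<kappa>) * (1 + - \<kappa> * (1 - \<kappa>)) = 1 + \<kappa> ^ 3" by (simp add: algebra_simps power3_eq_cube)
      then show ?thesis using \<kappa> by simp
    qed
    also have "\<dots> \<le> (1 + \<kappa>) * exp (- \<kappa> * (1 - \<kappa>))" using \<kappa> by (intro mult_left_mono exp_ge_add_one_self) auto
    finally have "exp (- (- \<kappa> * (1 - \<kappa>))) < 1 + \<kappa>" by (rule flip)
    then show ?thesis unfolding \<rho>2_def half using \<kappa> by simp
  qed
  have r3: "\<rho>3 < 1" using \<kappa> s by (simp add: \<rho>3_def)
  have nn: "0 \<le> \<rho>1" "0 \<le> \<rho>2" "0 \<le> \<rho>3" using u \<kappa> by (auto simp: \<rho>1_def \<rho>2_def \<rho>3_def)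
  define \<rho> where "\<rho> = max \<rho>1 (max \<rho>2 \<rho>3)"
  have \<rho>: "0 \<le> \<rho>" "\<rho> < 1" "\<rho>1 \<le> \<rho>" "\<rho>2 \<le> \<rho>" "\<rho>3 \<le> \<rho>" using r1 r2 r3 nn by (auto simp: \<rho>_def)
  define L where "L n \<omega> = ennreal (exp (\<Sum>k<n. - (l * (X i k \<omega> - \<mu> i)\<^sup>2)))" for n \<omega>
  have [measurable]: "L n \<in> borel_measurable M" for n unfolding L_def by measurable
  have bound: "(\<integral>\<^sup>+\<omega>. L n \<omega> * indicator (space M - typical i s \<kappa> n) \<omega> \<partial>M) \<le> ennreal ((s / \<sigma> i) ^ n * (4 * \<rho> ^ n))" for n
  proof -
    define W V where "W \<omega> = (\<Sum>k<n. (X i k \<omega> - \<mu> i)\<^sup>2)" and "V \<omega> = (\<Sum>k<n. X i k \<omega> - \<mu> i)" for \<omega>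
    have [measurable]: "W \<in> borel_measurable M" "V \<in> borel_measurable M" unfolding W_def V_def by measurable
    define A B C D where "A = {\<omega>. real n * (u * (1 + \<kappa>) * s\<^sup>2) \<le> u * W \<omega>}"
      and "B = {\<omega>. real n * (- \<kappa> * (1 - \<kappa>) * s\<^sup>2) \<le> - \<kappa> * W \<omega>}"
      and "C = {\<omega>. real n * ((\<kappa> / s\<^sup>2)\<^sup>2 * s\<^sup>2) \<le> \<kappa> / s\<^sup>2 * V \<omega>}"
      and "D = {\<omega>. real n * ((- \<kappa> / s\<^sup>2)\<^sup>2 * s\<^sup>2) \<le> - \<kappa> / s\<^sup>2 * V \<omega>}"
    have cover: "\<omega> \<in> A \<or> \<omega> \<in> B \<or> \<omega> \<in> C \<or> \<omega> \<in> D" if "\<omega> \<in> space M - typical i s \<kappa> n" for \<omega>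
    proof -
      have A: "A = {\<omega>. real n * ((1 + \<kappa>) * s\<^sup>2) \<le> W \<omega>}"
        unfolding A_def using u(1) mult_le_cancel_left_pos[of u "real n * ((1 + \<kappa>) * s\<^sup>2)"] by (simp add: mult_ac)
      have B: "B = {\<omega>. W \<omega> \<le> real n * ((1 - \<kappa>) * s\<^sup>2)}"
        unfolding B_def using \<kappa> mult_le_cancel_left_pos[of \<kappa> _ "real n * ((1 - \<kappa>) * s\<^sup>2)"] by (simp add: mult_ac)
      have C: "C = {\<omega>. real n * \<kappa> \<le> V \<omega>}"
      proof -
        have "real n * ((\<kappa> / s\<^sup>2)\<^sup>2 * s\<^sup>2) = \<kappa> / s\<^sup>2 * (real n * \<kappa>)" using s by (simp add: power2_eq_square)
        then show ?thesis unfolding C_def using \<kappa> s by (simp add: mult_le_cancel_left_pos divide_le_cancel)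
      qed
      have D: "D = {\<omega>. V \<omega> \<le> - (real n * \<kappa>)}"
      proof -
        have "real n * ((- \<kappa> / s\<^sup>2)\<^sup>2 * s\<^sup>2) = - \<kappa> / s\<^sup>2 * - (real n * \<kappa>)" using s by (simp add: power2_eq_square)
        moreover have "- \<kappa> / s\<^sup>2 < 0" using \<kappa> s by simp
        ultimately show ?thesis unfolding D_def by (simp only: mult_le_cancel_left_neg)
      qed
      show ?thesis using that unfolding A B C D typical_def W_def[symmetric] V_def[symmetric] by auto
    qed
    have ABCD: "(\<integral>\<^sup>+\<omega>. L n \<omega> * indicator A \<omega> \<partial>M) \<le> ennreal ((s / \<sigma> i * \<rho>1) ^ n)"
      "(\<integral>\<^sup>+\<omega>. L n \<omega> * indicator B \<omega> \<partial>M) \<le> ennreal ((s / \<sigma> i * \<rho>2) ^ n)"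
      "(\<integral>\<^sup>+\<omega>. L n \<omega> * indicator C \<omega> \<partial>M) \<le> ennreal ((s / \<sigma> i * \<rho>3) ^ n)"
      "(\<integral>\<^sup>+\<omega>. L n \<omega> * indicator D \<omega> \<partial>M) \<le> ennreal ((s / \<sigma> i * \<rho>3) ^ n)"
    proof -
      show "(\<integral>\<^sup>+\<omega>. L n \<omega> * indicator A \<omega> \<partial>M) \<le> ennreal ((s / \<sigma> i * \<rho>1) ^ n)"
        unfolding L_def A_def W_def \<rho>1_def by (rule tilted_quadratic_tail[OF i s u(2) l])
      show "(\<integral>\<^sup>+\<omega>. L n \<omega> * indicator B \<omega> \<partial>M) \<le> ennreal ((s / \<sigma> i * \<rho>2) ^ n)"
        unfolding L_def B_def W_def \<rho>2_def using \<kappa> by (intro tilted_quadratic_tail[OF i s _ l]) auto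
      have h: "(h / s\<^sup>2)\<^sup>2 * s\<^sup>2 = h\<^sup>2 / s\<^sup>2" for h using s by (simp add: power2_eq_square)
      show "(\<integral>\<^sup>+\<omega>. L n \<omega> * indicator C \<omega> \<partial>M) \<le> ennreal ((s / \<sigma> i * \<rho>3) ^ n)"
        using tilted_linear_tail[OF i s l, of n "\<kappa> / s\<^sup>2"] unfolding L_def C_def V_def \<rho>3_def h .
      show "(\<integral>\<^sup>+\<omega>. L n \<omega> * indicator D \<omega> \<partial>M) \<le> ennreal ((s / \<sigma> i * \<rho>3) ^ n)"
        using tilted_linear_tail[OF i s l, of n "- \<kappa> / s\<^sup>2"] unfolding L_def D_def V_def \<rho>3_def h power2_minus .
    qed
    have me: "(\<lambda>\<omega>. L n \<omega> * indicator A \<omega>) \<in> borel_measurable M" "(\<lambda>\<omega>. L n \<omega> * indicator B \<omega>) \<in> borel_measurable M"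
      "(\<lambda>\<omega>. L n \<omega> * indicator C \<omega>) \<in> borel_measurable M" "(\<lambda>\<omega>. L n \<omega> * indicator D \<omega>) \<in> borel_measurable M"
      unfolding A_def B_def C_def D_def by measurable
    have "(\<integral>\<^sup>+\<omega>. L n \<omega> * indicator (space M - typical i s \<kappa> n) \<omega> \<partial>M)
       \<le> (\<integral>\<^sup>+\<omega>. L n \<omega> * indicator A \<omega> + (L n \<omega> * indicator B \<omega> + (L n \<omega> * indicator C \<omega> + L n \<omega> * indicator D \<omega>)) \<partial>M)"
      using cover by (intro nn_integral_mono) (auto simp: indicator_def)
    also have "\<dots> = (\<integral>\<^sup>+\<omega>. L n \<omega> * indicator A \<omega> \<partial>M) + ((\<integral>\<^sup>+\<omega>. L n \<omega> * indicator B \<omega> \<partial>M)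
        + ((\<integral>\<^sup>+\<omega>. L n \<omega> * indicator C \<omega> \<partial>M) + (\<integral>\<^sup>+\<omega>. L n \<omega> * indicator D \<omega> \<partial>M)))"
      using me by (simp add: nn_integral_add)
    also have "\<dots> \<le> ennreal ((s / \<sigma> i * \<rho>1) ^ n) + (ennreal ((s / \<sigma> i * \<rho>2) ^ n)
        + (ennreal ((s / \<sigma> i * \<rho>3) ^ n) + ennreal ((s / \<sigma> i * \<rho>3) ^ n)))"
      by (intro add_mono ABCD)
    also have "\<dots> \<le> ennreal ((s / \<sigma> i * \<rho>) ^ n) + (ennreal ((s / \<sigma> i * \<rho>) ^ n)
        + (ennreal ((s / \<sigma> i * \<rho>) ^ n) + ennreal ((s / \<sigma> i * \<rho>) ^ n)))"
      using s sp nn \<rho> by (intro add_mono ennreal_leI power_mono mult_left_mono) (auto intro!: divide_nonneg_pos)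
    also have "\<dots> = ennreal ((s / \<sigma> i) ^ n * (4 * \<rho> ^ n))"
      using s sp \<rho>(1) by (simp add: ennreal_plus[symmetric] power_mult_distrib power_divide del: ennreal_plus)
    finally show ?thesis .
  qed
  show ?thesis using \<rho>(1,2) bound unfolding L_def by blast
qed

text \<open>
  At least half of the total weight lies on the typical event, and there the weight is at most
  \<open>exp (- n l s\<^sup>2)\<close> up to the error \<open>exp (n \<bar>l\<bar> \<kappa> s\<^sup>2)\<close>. Dividing one by the other bounds the probability
  from below.
\<close>
lemma prob_typical_ge:
  assumes i: "i \<in> {1, 2}" and s: "s > 0" and \<kappa>: "\<kappa> > 0"
    and l: "l = (1 / s\<^sup>2 - 1 / (\<sigma> i)\<^sup>2) / 2"
  shows "eventually (\<lambda>n. exp (- (real n * (tilt_rate (\<sigma> i) s + \<bar>l\<bar> * \<kappa> * s\<^sup>2))) / 2 \<le> prob (typical i s \<kappa> n)) sequentially"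
proof -
  have sp: "\<sigma> i > 0" using sigma_pos i by auto
  have [measurable]: "X i k \<in> borel_measurable M" for k using X_measurable i by auto
  have [measurable]: "typical i s \<kappa> n \<in> events" for n using typical_measurable[OF i] .
  obtain \<rho> where \<rho>: "0 \<le> \<rho>" "\<rho> < 1" and at: "\<And>n. (\<integral>\<^sup>+\<omega>. ennreal (exp (\<Sum>k<n. - (l * (X i k \<omega> - \<mu> i)\<^sup>2))) * indicator (space M - typical i s \<kappa> n) \<omega> \<partial>M)
       \<le> ennreal ((s / \<sigma> i) ^ n * (4 * \<rho> ^ n))"
    using tilted_atypical_le[OF i s \<kappa> l] by blast
  have "(\<lambda>n. \<rho> ^ n) \<longlonglongrightarrow> 0" using \<rho> by (intro LIMSEQ_power_zero) auto
  then have "eventually (\<lambda>n. \<rho> ^ n < 1 / 8) sequentially" by (rule order_tendstoD) simp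
  then show ?thesis
  proof eventually_elim
    case (elim n)
    define L where "L \<omega> = ennreal (exp (\<Sum>k<n. - (l * (X i k \<omega> - \<mu> i)\<^sup>2)))" for \<omega>
    have [measurable]: "L \<in> borel_measurable M" unfolding L_def by measurable
    define q where "q = (s / \<sigma> i) ^ n"
    have q: "q > 0" unfolding q_def using s sp by simp
    define m where "m = exp (- (real n * (l * s\<^sup>2)) + real n * (\<bar>l\<bar> * \<kappa> * s\<^sup>2))"
    have "ennreal q = (\<integral>\<^sup>+\<omega>. L \<omega> \<partial>M)"
      unfolding L_def q_def
      using nn_integral_exp_sum_design[OF i, of "\<lambda>x. - (l * (x - \<mu> i)\<^sup>2)" n] nn_integral_exp_square_about[OF i s l, of _ "\<mu> i"] s sp
      by (simp add: ennreal_power)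
    also have "\<dots> = (\<integral>\<^sup>+\<omega>. L \<omega> * indicator (typical i s \<kappa> n) \<omega> + L \<omega> * indicator (space M - typical i s \<kappa> n) \<omega> \<partial>M)"
      by (intro nn_integral_cong) (auto simp: indicator_def)
    also have "\<dots> = (\<integral>\<^sup>+\<omega>. L \<omega> * indicator (typical i s \<kappa> n) \<omega> \<partial>M) + (\<integral>\<^sup>+\<omega>. L \<omega> * indicator (space M - typical i s \<kappa> n) \<omega> \<partial>M)"
      by (intro nn_integral_add) measurable
    also have "\<dots> \<le> (\<integral>\<^sup>+\<omega>. ennreal m * indicator (typical i s \<kappa> n) \<omega> \<partial>M) + ennreal (q / 2)"
    proof (intro add_mono nn_integral_mono)
      show "(\<integral>\<^sup>+\<omega>. L \<omega> * indicator (space M - typical i s \<kappa> n) \<omega> \<partial>M) \<le> ennreal (q / 2)"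
        unfolding L_def by (rule order_trans[OF at]) (use elim q in \<open>auto simp: q_def[symmetric] intro!: ennreal_leI\<close>)
      fix \<omega>
      show "L \<omega> * indicator (typical i s \<kappa> n) \<omega> \<le> ennreal m * indicator (typical i s \<kappa> n) \<omega>"
      proof (cases "\<omega> \<in> typical i s \<kappa> n")
        case True
        define W where "W = (\<Sum>k<n. (X i k \<omega> - \<mu> i)\<^sup>2)"
        have "\<bar>W - real n * s\<^sup>2\<bar> \<le> real n * (\<kappa> * s\<^sup>2)"
        proof -
          have "real n * ((1 - \<kappa>) * s\<^sup>2) < W" "W < real n * ((1 + \<kappa>) * s\<^sup>2)"
            using True by (auto simp: typical_def W_def)
          then show ?thesis by (simp add: algebra_simps abs_le_iff)
        qed
        then have "\<bar>l\<bar> * \<bar>W - real n * s\<^sup>2\<bar> \<le> \<bar>l\<bar> * (real n * (\<kappa> * s\<^sup>2))" by (intro mult_left_mono) auto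
        moreover have "- (l * (W - real n * s\<^sup>2)) \<le> \<bar>l\<bar> * \<bar>W - real n * s\<^sup>2\<bar>"
          unfolding abs_mult[symmetric] by linarith
        ultimately have "- (l * W) \<le> - (real n * (l * s\<^sup>2)) + real n * (\<bar>l\<bar> * \<kappa> * s\<^sup>2)"
          by (simp add: algebra_simps)
        then show ?thesis
          unfolding L_def m_def by (auto simp: W_def sum_distrib_left sum_negf intro!: ennreal_leI mult_right_mono)
      qed simp
    qed
    also have "\<dots> = ennreal (m * prob (typical i s \<kappa> n) + q / 2)"
      using q by (simp add: nn_integral_cmult_indicator emeasure_eq_measure ennreal_mult'[symmetric] m_def)
    finally have "q \<le> m * prob (typical i s \<kappa> n) + q / 2"
      using q by (subst (asm) ennreal_le_iff) (auto simp: m_def intro!: add_nonneg_nonneg)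
    then have "q / m / 2 \<le> prob (typical i s \<kappa> n)" by (simp add: field_simps m_def)
    moreover have "q / m = exp (- (real n * (tilt_rate (\<sigma> i) s + \<bar>l\<bar> * \<kappa> * s\<^sup>2)))"
    proof -
      have "q = exp (real n * ln (s / \<sigma> i))" unfolding q_def using s sp by (simp add: exp_of_nat_mult)
      moreover have ls: "l * s\<^sup>2 = - ((s\<^sup>2 / (\<sigma> i)\<^sup>2 - 1) / 2)" unfolding l using s sp by (simp add: field_simps)
      have "real n * ln (s / \<sigma> i) - (- (real n * (l * s\<^sup>2)) + real n * (\<bar>l\<bar> * \<kappa> * s\<^sup>2))
          = - (real n * (tilt_rate (\<sigma> i) s + \<bar>l\<bar> * \<kappa> * s\<^sup>2))"
        unfolding ls tilt_rate_def by (simp add: algebra_simps diff_divide_distrib)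
      ultimately show ?thesis unfolding m_def by (simp only: exp_diff[symmetric])
    qed
    ultimately show ?case by simp
  qed
qed

text \<open>
  The sample variance divides by \<open>n - 1\<close> instead of \<open>n\<close>; the second factor \<open>1 + \<kappa>\<close> in the upper
  bound absorbs the difference.
\<close>
lemma typical_sample_sd:
  assumes \<omega>: "\<omega> \<in> typical i s \<kappa> n" and "n > 1" "\<kappa> > 0" "1 / \<kappa> + 1 \<le> real n"
  shows "sqrt ((1 - \<kappa>) * s\<^sup>2 - \<kappa>\<^sup>2) \<le> sample_sd (\<lambda>k. X i k \<omega>) n"
    "sample_sd (\<lambda>k. X i k \<omega>) n \<le> sqrt ((1 + \<kappa>) * ((1 + \<kappa>) * s\<^sup>2))"
proof -
  define Q where "Q = sq_dev (\<lambda>k. X i k \<omega>) n"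
  define W where "W = (\<Sum>k<n. (X i k \<omega> - \<mu> i)\<^sup>2)"
  define V where "V = (\<Sum>k<n. X i k \<omega> - \<mu> i)"
  have *: "real n * ((1 - \<kappa>) * s\<^sup>2) < W" "W < real n * ((1 + \<kappa>) * s\<^sup>2)" "\<bar>V\<bar> < real n * \<kappa>"
    using \<omega> by (auto simp: typical_def W_def V_def)
  have "sample_mean (\<lambda>k. X i k \<omega>) {..<n} = \<mu> i + V / real n"
    using \<open>n > 1\<close> by (simp add: sample_mean_def V_def sum_subtractf field_simps)
  then have WQ: "W = Q + real n * (V / real n)\<^sup>2"
    unfolding W_def Q_def using sum_square_shift[of n "\<lambda>k. X i k \<omega>" "\<mu> i"] \<open>n > 1\<close> by simp
  have "\<bar>V / real n\<bar> \<le> \<kappa>" using * \<open>n > 1\<close> by (simp add: field_simps)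
  then have "(V / real n)\<^sup>2 \<le> \<kappa>\<^sup>2" using \<open>\<kappa> > 0\<close> by (metis abs_ge_zero power2_abs power_mono)
  then have "real n * (V / real n)\<^sup>2 \<le> real n * \<kappa>\<^sup>2" by (intro mult_left_mono) auto
  then have lo: "real n * ((1 - \<kappa>) * s\<^sup>2 - \<kappa>\<^sup>2) \<le> Q" using * WQ by (simp add: algebra_simps)
  have "Q \<le> W" unfolding WQ by simp
  then have hi: "Q \<le> real n * ((1 + \<kappa>) * s\<^sup>2)" using * by simp
  have Q0: "0 \<le> Q" by (simp add: Q_def sq_dev_nonneg)
  have "(1 - \<kappa>) * s\<^sup>2 - \<kappa>\<^sup>2 \<le> Q / real n" using lo \<open>n > 1\<close> by (simp add: field_simps)
  also have "\<dots> \<le> Q / (real n - 1)" using Q0 \<open>n > 1\<close> by (intro divide_left_mono) auto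
  finally show "sqrt ((1 - \<kappa>) * s\<^sup>2 - \<kappa>\<^sup>2) \<le> sample_sd (\<lambda>k. X i k \<omega>) n"
    unfolding sample_sd_eq Q_def by simp
  have "1 \<le> \<kappa> * (real n - 1)" using assms(3,4) by (simp add: field_simps)
  then have "real n \<le> (real n - 1) * (1 + \<kappa>)" by (simp add: algebra_simps)
  then have "real n * ((1 + \<kappa>) * s\<^sup>2) \<le> (real n - 1) * (1 + \<kappa>) * ((1 + \<kappa>) * s\<^sup>2)"
    using \<open>\<kappa> > 0\<close> by (intro mult_right_mono) auto
  then have "Q / (real n - 1) \<le> (1 + \<kappa>) * ((1 + \<kappa>) * s\<^sup>2)"
    using hi \<open>n > 1\<close> by (simp add: field_simps)
  then show "sample_sd (\<lambda>k. X i k \<omega>) n \<le> sqrt ((1 + \<kappa>) * ((1 + \<kappa>) * s\<^sup>2))"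
    unfolding sample_sd_eq Q_def by simp
qed

lemma indep_sample_sd:
  "indep_var borel (\<lambda>\<omega>. sample_sd (\<lambda>k. X 1 k \<omega>) n) borel (\<lambda>\<omega>. sample_sd (\<lambda>k. X 2 k \<omega>) n)"
proof -
  define J where "J i = {i} \<times> {..<n}" for i :: nat
  define F where "F i z = sample_sd (\<lambda>k. z (i, k)) n" for i and z :: "nat \<times> nat \<Rightarrow> real"
  have F: "F i \<in> borel_measurable (PiM (J i) (\<lambda>_. borel))" for i
  proof -
    have comp: "(\<lambda>z. z (i, k)) \<in> borel_measurable (PiM (J i) (\<lambda>_. borel))" if "k < n" for k
      using that by (intro measurable_component_singleton) (simp add: J_def)
    show ?thesis unfolding F_def sample_sd_def sample_mean_def
      by (intro measurable_compose[OF _ borel_measurable_sqrt] borel_measurable_divide borel_measurable_sum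
          borel_measurable_power borel_measurable_diff borel_measurable_const comp) auto
  qed
  have "indep_var borel (F 1 \<circ> (\<lambda>\<omega>. restrict (\<lambda>p. (\<lambda>(i, k). X i k) p \<omega>) (J 1))) borel (F 2 \<circ> (\<lambda>\<omega>. restrict (\<lambda>p. (\<lambda>(i, k). X i k) p \<omega>) (J 2)))"
    by (rule indep_var_compose[OF indep_var_restrict[OF indep] F F]) (auto simp: J_def)
  moreover have "F i \<circ> (\<lambda>\<omega>. restrict (\<lambda>p. (\<lambda>(i, k). X i k) p \<omega>) (J i)) = (\<lambda>\<omega>. sample_sd (\<lambda>k. X i k \<omega>) n)" for i
    by (simp add: fun_eq_iff F_def sample_sd_def sample_mean_def J_def)
  ultimately show ?thesis by simp
qed

lemma prob_sample_sd_near_ge: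
  assumes i: "i \<in> {1, 2}" and s: "s > 0" and \<epsilon>: "\<epsilon> > 0"
  shows "eventually (\<lambda>n. exp (- (real n * (tilt_rate (\<sigma> i) s + \<epsilon>)))
    \<le> prob {\<omega> \<in> space M. \<bar>sample_sd (\<lambda>k. X i k \<omega>) n - s\<bar> < \<epsilon>}) sequentially"
proof -
  define l where "l = (1 / s\<^sup>2 - 1 / (\<sigma> i)\<^sup>2) / 2"
  have [measurable]: "(\<lambda>\<omega>. sample_sd (\<lambda>k. X i k \<omega>) n) \<in> borel_measurable M" for n
    unfolding sample_sd_eq using sq_dev_measurable[OF i] by measurable
  have "((\<lambda>\<kappa>. \<bar>l\<bar> * \<kappa> * s\<^sup>2) \<longlongrightarrow> \<bar>l\<bar> * 0 * s\<^sup>2) (at_right 0)"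
    "((\<lambda>\<kappa>. sqrt ((1 - \<kappa>) * s\<^sup>2 - \<kappa>\<^sup>2)) \<longlongrightarrow> sqrt ((1 - 0) * s\<^sup>2 - 0\<^sup>2)) (at_right 0)"
    "((\<lambda>\<kappa>. sqrt ((1 + \<kappa>) * ((1 + \<kappa>) * s\<^sup>2))) \<longlongrightarrow> sqrt ((1 + 0) * ((1 + 0) * s\<^sup>2))) (at_right 0)"
    by (intro tendsto_intros)+
  note lim = this
  have "eventually (\<lambda>\<kappa>. \<bar>l\<bar> * \<kappa> * s\<^sup>2 < \<epsilon> / 2) (at_right 0)"
    "eventually (\<lambda>\<kappa>. s - \<epsilon> < sqrt ((1 - \<kappa>) * s\<^sup>2 - \<kappa>\<^sup>2)) (at_right 0)"
    "eventually (\<lambda>\<kappa>. sqrt ((1 + \<kappa>) * ((1 + \<kappa>) * s\<^sup>2)) < s + \<epsilon>) (at_right 0)"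
    using s \<epsilon> by (auto intro!: order_tendstoD[OF lim(1)] order_tendstoD[OF lim(2)] order_tendstoD[OF lim(3)] simp del: times_divide_eq_right divide_const_simps)
  moreover have "eventually (\<lambda>\<kappa>::real. \<kappa> > 0) (at_right 0)" by (simp add: eventually_at_right_less)
  ultimately have "eventually (\<lambda>\<kappa>. \<kappa> > 0 \<and> \<bar>l\<bar> * \<kappa> * s\<^sup>2 < \<epsilon> / 2 \<and> s - \<epsilon> < sqrt ((1 - \<kappa>) * s\<^sup>2 - \<kappa>\<^sup>2)
      \<and> sqrt ((1 + \<kappa>) * ((1 + \<kappa>) * s\<^sup>2)) < s + \<epsilon>) (at_right 0)"
    by eventually_elim auto
  then obtain \<kappa> where \<kappa>: "\<kappa> > 0" "\<bar>l\<bar> * \<kappa> * s\<^sup>2 < \<epsilon> / 2" "s - \<epsilon> < sqrt ((1 - \<kappa>) * s\<^sup>2 - \<kappa>\<^sup>2)"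
      "sqrt ((1 + \<kappa>) * ((1 + \<kappa>) * s\<^sup>2)) < s + \<epsilon>"
    using eventually_happens'[OF trivial_limit_at_right_real] by blast
  have "filterlim real at_top sequentially" by (rule filterlim_real_sequentially)
  then have ev: "eventually (\<lambda>n. 1 / \<kappa> + 1 \<le> real n) sequentially"
    "eventually (\<lambda>n. 2 * ln 2 / \<epsilon> \<le> real n) sequentially"
    by (auto simp: filterlim_at_top)
  show ?thesis
    using prob_typical_ge[OF i s \<kappa>(1) l_def] ev eventually_gt_at_top[of 1]
  proof eventually_elim
    case (elim n)
    have "ln 2 \<le> real n * (\<epsilon> / 2)" using elim(3) \<epsilon> by (simp add: field_simps)
    also have "real n * (\<epsilon> / 2) \<le> real n * (\<epsilon> - \<bar>l\<bar> * \<kappa> * s\<^sup>2)"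
      using \<kappa>(2) by (intro mult_left_mono) auto
    finally have "- (real n * (tilt_rate (\<sigma> i) s + \<epsilon>)) \<le> - (real n * (tilt_rate (\<sigma> i) s + \<bar>l\<bar> * \<kappa> * s\<^sup>2)) - ln 2"
      by (simp add: algebra_simps)
    then have "exp (- (real n * (tilt_rate (\<sigma> i) s + \<epsilon>))) \<le> exp (- (real n * (tilt_rate (\<sigma> i) s + \<bar>l\<bar> * \<kappa> * s\<^sup>2)) - ln 2)"
      by simp
    also have "\<dots> = exp (- (real n * (tilt_rate (\<sigma> i) s + \<bar>l\<bar> * \<kappa> * s\<^sup>2))) / 2"
      by (simp add: exp_diff)
    also note elim(1)
    also have "prob (typical i s \<kappa> n) \<le> prob {\<omega> \<in> space M. \<bar>sample_sd (\<lambda>k. X i k \<omega>) n - s\<bar> < \<epsilon>}"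
    proof (rule finite_measure_mono)
      show "typical i s \<kappa> n \<subseteq> {\<omega> \<in> space M. \<bar>sample_sd (\<lambda>k. X i k \<omega>) n - s\<bar> < \<epsilon>}"
      proof
        fix \<omega> assume \<omega>: "\<omega> \<in> typical i s \<kappa> n"
        then show "\<omega> \<in> {\<omega> \<in> space M. \<bar>sample_sd (\<lambda>k. X i k \<omega>) n - s\<bar> < \<epsilon>}"
          using typical_sample_sd[OF \<omega> elim(4) \<kappa>(1) elim(2)] \<kappa>(3,4) by (auto simp: typical_def)
      qed
    qed measurable
    finally show ?case .
  qed
qed

end

section \<open>Phase II under the estimated allocation\<close>

lemma sample_sd_nonneg: "0 \<le> sample_sd y n"
proof (cases n)
  case (Suc m)
  then show ?thesis by (simp add: sample_sd_eq sq_dev_nonneg)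
qed (simp add: sample_sd_eq sq_dev_def)

lemma p_hat_range: "p_hat \<alpha>0 T x \<in> {0..1}"
proof -
  have "a / (a + b) \<in> {0..1}" if "a \<ge> 0" "b \<ge> 0" for a b :: real
    using that by (cases "a + b = 0") (auto simp: divide_le_eq_1)
  then show ?thesis unfolding p_hat_def using sample_sd_nonneg by blast
qed

text \<open>
  The phase-II sample sizes as functions of the estimated fraction alone. This separates the
  phase-I data from the phase-II data.
\<close>
definition allocation :: "real \<Rightarrow> nat \<Rightarrow> nat \<Rightarrow> real \<Rightarrow> nat" where
  "allocation \<alpha>0 T i q = nat (\<lfloor>(1 - \<alpha>0) * (if i = 1 then q else 1 - q) * real T\<rfloor> + 1)"

lemma phase2_size_eq: "phase2_size \<alpha>0 T x i = allocation \<alpha>0 T i (p_hat \<alpha>0 T x)"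
  by (simp add: phase2_size_def allocation_def)

lemma allocation_bounds:
  assumes "q \<in> {0..1}" "\<alpha>0 \<in> {0<..<1}"
  shows "(1 - \<alpha>0) * (if i = 1 then q else 1 - q) * real T < real (allocation \<alpha>0 T i q)"
    "real (allocation \<alpha>0 T i q) \<le> (1 - \<alpha>0) * (if i = 1 then q else 1 - q) * real T + 1"
    "0 < allocation \<alpha>0 T i q" "allocation \<alpha>0 T i q \<le> Suc T"
proof -
  define y where "y = (1 - \<alpha>0) * (if i = 1 then q else 1 - q) * real T"
  have y0: "0 \<le> y" using assms by (auto simp: y_def)
  have y1: "y \<le> real T"
  proof -
    have "(1 - \<alpha>0) * (if i = 1 then q else 1 - q) \<le> 1" using assms by (intro mult_le_one) auto
    then show ?thesis unfolding y_def using mult_right_mono[of _ 1 "real T"] by simp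
  qed
  have eq: "real (allocation \<alpha>0 T i q) = of_int \<lfloor>y\<rfloor> + 1"
  proof -
    have "allocation \<alpha>0 T i q = nat (\<lfloor>y\<rfloor> + 1)" by (simp only: allocation_def y_def)
    then show ?thesis using y0 by simp
  qed
  show "(1 - \<alpha>0) * (if i = 1 then q else 1 - q) * real T < real (allocation \<alpha>0 T i q)"
    "real (allocation \<alpha>0 T i q) \<le> (1 - \<alpha>0) * (if i = 1 then q else 1 - q) * real T + 1"
    unfolding y_def[symmetric] eq by linarith+
  have "0 < real (allocation \<alpha>0 T i q)" "real (allocation \<alpha>0 T i q) \<le> real T + 1"
    unfolding eq using y0 y1 by linarith+
  then show "0 < allocation \<alpha>0 T i q" "allocation \<alpha>0 T i q \<le> Suc T" by linarith+
qed

lemma allocation_measurable [measurable]: "allocation \<alpha>0 T i \<in> measurable borel (count_space UNIV)"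
  unfolding allocation_def by measurable

text \<open>
  For \<open>x > 0\<close> the exponent \<open>(x + \<delta>)\<^sup>2\<close> exceeds \<open>x\<^sup>2 + \<delta>\<^sup>2\<close>, which gives the upper bound. For the lower
  bound only the interval \<open>{0<..\<tau>}\<close> is kept, on which the density is at least its value at \<open>\<tau>\<close>.
\<close>
lemma (in prob_space) normal_prob_pos:
  assumes Y: "distributed M lborel Y (normal_density (- \<delta>) \<tau>)" and "\<tau> > 0" "\<delta> \<ge> 0"
  shows "prob {\<omega> \<in> space M. Y \<omega> > 0} \<le> exp (- (\<delta>\<^sup>2 / (2 * \<tau>\<^sup>2)))"
    and "exp (- ((\<delta> / \<tau> + 1)\<^sup>2 / 2)) / sqrt (2 * pi) \<le> prob {\<omega> \<in> space M. Y \<omega> > 0}"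
proof -
  have set_eq: "{\<omega> \<in> space M. Y \<omega> > 0} = Y -` {0<..} \<inter> space M" by auto
  have em: "ennreal (prob {\<omega> \<in> space M. Y \<omega> > 0}) = (\<integral>\<^sup>+x. ennreal (normal_density (- \<delta>) \<tau> x) * indicator {0<..} x \<partial>lborel)"
    unfolding emeasure_eq_measure[symmetric] set_eq by (rule distributed_emeasure[OF Y]) simp
  have "ennreal (prob {\<omega> \<in> space M. Y \<omega> > 0}) \<le> (\<integral>\<^sup>+x. ennreal (exp (- (\<delta>\<^sup>2 / (2 * \<tau>\<^sup>2)))) * ennreal (normal_density 0 \<tau> x) \<partial>lborel)"
    unfolding em
  proof (rule nn_integral_mono)
    fix x :: real
    show "ennreal (normal_density (- \<delta>) \<tau> x) * indicator {0<..} x \<le> ennreal (exp (- (\<delta>\<^sup>2 / (2 * \<tau>\<^sup>2)))) * ennreal (normal_density 0 \<tau> x)"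
    proof (cases "x > 0")
      case True
      have "\<delta>\<^sup>2 + x\<^sup>2 \<le> (x - - \<delta>)\<^sup>2" using True \<open>\<delta> \<ge> 0\<close> by (simp add: power2_sum)
      then have "\<delta>\<^sup>2 / (2 * \<tau>\<^sup>2) + x\<^sup>2 / (2 * \<tau>\<^sup>2) \<le> (x - - \<delta>)\<^sup>2 / (2 * \<tau>\<^sup>2)"
        unfolding add_divide_distrib[symmetric] by (intro divide_right_mono) auto
      then have "exp (- (x - - \<delta>)\<^sup>2 / (2 * \<tau>\<^sup>2)) \<le> exp (- (\<delta>\<^sup>2 / (2 * \<tau>\<^sup>2))) * exp (- x\<^sup>2 / (2 * \<tau>\<^sup>2))"
        unfolding exp_add[symmetric] by simp
      then have "1 / sqrt (2 * pi * \<tau>\<^sup>2) * exp (- (x - - \<delta>)\<^sup>2 / (2 * \<tau>\<^sup>2))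
          \<le> 1 / sqrt (2 * pi * \<tau>\<^sup>2) * (exp (- (\<delta>\<^sup>2 / (2 * \<tau>\<^sup>2))) * exp (- x\<^sup>2 / (2 * \<tau>\<^sup>2)))"
        by (intro mult_left_mono) auto
      then have "normal_density (- \<delta>) \<tau> x \<le> exp (- (\<delta>\<^sup>2 / (2 * \<tau>\<^sup>2))) * normal_density 0 \<tau> x"
        unfolding normal_density_def by (simp add: mult_ac)
      then show ?thesis using True by (simp add: ennreal_mult'[symmetric])
    qed simp
  qed
  also have "\<dots> = ennreal (exp (- (\<delta>\<^sup>2 / (2 * \<tau>\<^sup>2))))"
    using \<open>\<tau> > 0\<close> by (subst nn_integral_cmult) (auto simp: nn_integral_normal_density)
  finally show "prob {\<omega> \<in> space M. Y \<omega> > 0} \<le> exp (- (\<delta>\<^sup>2 / (2 * \<tau>\<^sup>2)))" by simp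
  define c where "c = exp (- ((\<delta> / \<tau> + 1)\<^sup>2 / 2)) / (sqrt (2 * pi) * \<tau>)"
  have "ennreal (c * \<tau>) = ennreal c * emeasure lborel {0<..\<tau>}"
    using \<open>\<tau> > 0\<close> ennreal_mult''[of \<tau> c] by simp
  also have "\<dots> = (\<integral>\<^sup>+x. ennreal c * indicator {0<..\<tau>} x \<partial>lborel)"
    by (rule nn_integral_cmult_indicator[symmetric]) simp
  also have "\<dots> \<le> (\<integral>\<^sup>+x. ennreal (normal_density (- \<delta>) \<tau> x) * indicator {0<..} x \<partial>lborel)"
  proof (rule nn_integral_mono)
    fix x :: real
    show "ennreal c * indicator {0<..\<tau>} x \<le> ennreal (normal_density (- \<delta>) \<tau> x) * indicator {0<..} x"
    proof (cases "x \<in> {0<..\<tau>}")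
      case True
      then have "(x + \<delta>)\<^sup>2 \<le> (\<tau> + \<delta>)\<^sup>2" using \<open>\<delta> \<ge> 0\<close> by (intro power_mono) auto
      then have "(x + \<delta>)\<^sup>2 / (2 * \<tau>\<^sup>2) \<le> (\<tau> + \<delta>)\<^sup>2 / (2 * \<tau>\<^sup>2)" by (intro divide_right_mono) auto
      also have "\<dots> = (\<delta> / \<tau> + 1)\<^sup>2 / 2" using \<open>\<tau> > 0\<close> by (simp add: field_simps power2_eq_square)
      finally have "exp (- ((\<delta> / \<tau> + 1)\<^sup>2 / 2)) \<le> exp (- ((x + \<delta>)\<^sup>2 / (2 * \<tau>\<^sup>2)))" by simp
      then have "c \<le> normal_density (- \<delta>) \<tau> x"
        unfolding c_def normal_density_def using \<open>\<tau> > 0\<close> by (simp add: real_sqrt_mult divide_right_mono)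
      then show ?thesis using True by (auto intro: ennreal_leI)
    qed simp
  qed
  finally have "c * \<tau> \<le> prob {\<omega> \<in> space M. Y \<omega> > 0}" unfolding em[symmetric] by simp
  then show "exp (- ((\<delta> / \<tau> + 1)\<^sup>2 / 2)) / sqrt (2 * pi) \<le> prob {\<omega> \<in> space M. Y \<omega> > 0}"
    using \<open>\<tau> > 0\<close> by (simp add: c_def)
qed

context gaussian_pair
begin

definition mean_gap :: "nat \<Rightarrow> nat \<Rightarrow> nat \<Rightarrow> 'a \<Rightarrow> real" where
  "mean_gap n a b \<omega> = sample_mean (\<lambda>k. X 2 k \<omega>) {n..<n + b} - sample_mean (\<lambda>k. X 1 k \<omega>) {n..<n + a}"

lemma mean_gap_normal:
  assumes "a > 0" "b > 0"
  shows "distributed M lborel (mean_gap n a b) (normal_density (- (\<mu> 1 - \<mu> 2)) (sqrt ((\<sigma> 1)\<^sup>2 / real a + (\<sigma> 2)\<^sup>2 / real b)))"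
proof -
  define I where "I = {1::nat} \<times> {n..<n + a} \<union> {2} \<times> {n..<n + b}"
  define c where "c i = (if i = 1 then - 1 / real a else 1 / real b)" for i :: nat
  have I: "finite I" "I \<subseteq> {1, 2} \<times> UNIV" "I \<noteq> {}" using assms by (auto simp: I_def)
  have sum_I: "(\<Sum>p\<in>I. h p) = (\<Sum>k\<in>{n..<n + a}. h (1, k)) + (\<Sum>k\<in>{n..<n + b}. h (2, k))" for h :: "nat \<times> nat \<Rightarrow> real"
  proof -
    have "(\<Sum>p\<in>{i} \<times> A. h p) = (\<Sum>k\<in>A. h (i, k))" for i A
      by (rule sum.reindex_bij_witness[of _ "\<lambda>k. (i, k)" snd]) auto
    then show ?thesis unfolding I_def by (subst sum.union_disjoint) auto
  qed
  have ind: "indep_vars (\<lambda>_. borel) (\<lambda>p \<omega>. c (fst p) * (\<lambda>(i, k). X i k) p \<omega>) I"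
    by (rule indep_vars_compose2[OF indep_vars_subset[OF indep I(2)], where Y = "\<lambda>p x. c (fst p) * x"]) measurable
  have cpos: "c i \<noteq> 0" for i using assms by (auto simp: c_def)
  have d: "distributed M lborel (\<lambda>\<omega>. c (fst p) * (\<lambda>(i, k). X i k) p \<omega>)
      (normal_density (c (fst p) * \<mu> (fst p)) (\<bar>c (fst p)\<bar> * \<sigma> (fst p)))" if "p \<in> I" for p
  proof -
    have "fst p \<in> {1, 2}" using that I by auto
    from normal_density_affine[OF normal[OF this, of "snd p"] sigma_pos[OF this] cpos[of "fst p"], of 0] show ?thesis
      by (simp add: case_prod_beta)
  qed
  have "distributed M lborel (\<lambda>\<omega>. \<Sum>p\<in>I. c (fst p) * (\<lambda>(i, k). X i k) p \<omega>)
      (normal_density (\<Sum>p\<in>I. c (fst p) * \<mu> (fst p)) (sqrt (\<Sum>p\<in>I. (\<bar>c (fst p)\<bar> * \<sigma> (fst p))\<^sup>2)))"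
  proof (rule sum_indep_normal[OF I(1,3) ind])
    fix p assume p: "p \<in> I"
    then have "fst p \<in> {1, 2}" using I by auto
    then show "0 < \<bar>c (fst p)\<bar> * \<sigma> (fst p)" using sigma_pos cpos by (intro mult_pos_pos) simp_all
  qed (rule d)
  moreover have "(\<Sum>p\<in>I. c (fst p) * (\<lambda>(i, k). X i k) p \<omega>) = mean_gap n a b \<omega>" for \<omega>
    unfolding sum_I mean_gap_def sample_mean_def by (simp add: c_def sum_divide_distrib sum_negf)
  moreover have "(\<Sum>p\<in>I. c (fst p) * \<mu> (fst p)) = - (\<mu> 1 - \<mu> 2)"
    unfolding sum_I using assms by (simp add: c_def)
  moreover have "(\<Sum>p\<in>I. (\<bar>c (fst p)\<bar> * \<sigma> (fst p))\<^sup>2) = (\<sigma> 1)\<^sup>2 / real a + (\<sigma> 2)\<^sup>2 / real b"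
    unfolding sum_I using assms by (simp add: c_def power_divide power2_eq_square)
  ultimately show ?thesis by simp
qed

definition p_est :: "real \<Rightarrow> nat \<Rightarrow> 'a \<Rightarrow> real" where
  "p_est \<alpha>0 T \<omega> = p_hat \<alpha>0 T (\<lambda>i k. X i k \<omega>)"

definition false_selection :: "real \<Rightarrow> nat \<Rightarrow> 'a \<Rightarrow> bool" where
  "false_selection \<alpha>0 T \<omega> \<longleftrightarrow> phase2_mean \<alpha>0 T (\<lambda>i k. X i k \<omega>) 1 < phase2_mean \<alpha>0 T (\<lambda>i k. X i k \<omega>) 2"

lemma false_selection_iff:
  "false_selection \<alpha>0 T \<omega> \<longleftrightarrow>
    0 < mean_gap (phase1_size \<alpha>0 T) (allocation \<alpha>0 T 1 (p_est \<alpha>0 T \<omega>)) (allocation \<alpha>0 T 2 (p_est \<alpha>0 T \<omega>)) \<omega>"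
  by (simp add: false_selection_def phase2_mean_def mean_gap_def phase2_size_eq p_est_def)

lemma indep_p_est_mean_gap:
  "indep_var borel (p_est \<alpha>0 T) borel (mean_gap (phase1_size \<alpha>0 T) a b)"
proof -
  define n where "n = phase1_size \<alpha>0 T"
  define A B where "A = {1::nat, 2} \<times> {..<n}" and "B = {1::nat, 2} \<times> {n..}"
  define F where "F z = p_hat \<alpha>0 T (\<lambda>i k. z (i, k))" for z :: "nat \<times> nat \<Rightarrow> real"
  define G where "G z = sample_mean (\<lambda>k. z (2, k)) {n..<n + b} - sample_mean (\<lambda>k. z (1, k)) {n..<n + a}" for z :: "nat \<times> nat \<Rightarrow> real"
  have comp: "(\<lambda>z. z p) \<in> borel_measurable (PiM J (\<lambda>_. borel))" if "p \<in> J" for p and J :: "(nat \<times> nat) set"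
    using that by measurable
  have F: "F \<in> borel_measurable (PiM A (\<lambda>_. borel))"
    unfolding F_def p_hat_def sample_sd_def sample_mean_def n_def[symmetric]
    by (intro borel_measurable_divide borel_measurable_add borel_measurable_sqrt borel_measurable_sum
        borel_measurable_power borel_measurable_diff borel_measurable_const comp) (auto simp: A_def)
  have G: "G \<in> borel_measurable (PiM B (\<lambda>_. borel))"
    unfolding G_def sample_mean_def
    by (intro borel_measurable_divide borel_measurable_sum
        borel_measurable_diff borel_measurable_const comp) (auto simp: B_def)
  have "indep_var borel (F \<circ> (\<lambda>\<omega>. restrict (\<lambda>p. (\<lambda>(i, k). X i k) p \<omega>) A)) borel (G \<circ> (\<lambda>\<omega>. restrict (\<lambda>p. (\<lambda>(i, k). X i k) p \<omega>) B))"
    by (rule indep_var_compose[OF indep_var_restrict[OF indep] F G]) (auto simp: A_def B_def)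
  moreover have "F \<circ> (\<lambda>\<omega>. restrict (\<lambda>p. (\<lambda>(i, k). X i k) p \<omega>) A) = p_est \<alpha>0 T"
    by (simp add: fun_eq_iff F_def p_est_def p_hat_def sample_sd_def sample_mean_def n_def[symmetric] A_def)
  moreover have "G \<circ> (\<lambda>\<omega>. restrict (\<lambda>p. (\<lambda>(i, k). X i k) p \<omega>) B) = mean_gap n a b"
    by (simp add: fun_eq_iff G_def mean_gap_def sample_mean_def B_def)
  ultimately show ?thesis by (simp add: n_def)
qed

lemma p_est_measurable [measurable]: "p_est \<alpha>0 T \<in> borel_measurable M"
  using indep_var_rv1[OF indep_p_est_mean_gap[of _ _ 0 0]] .

lemma mean_gap_measurable: "mean_gap (phase1_size \<alpha>0 T) a b \<in> borel_measurable M"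
  using indep_var_rv2[OF indep_p_est_mean_gap] .

text \<open>
  On the part of the event where the sample sizes are \<open>a\<close> and \<open>b\<close>, a false selection is the event
  that the difference of two means with fixed sample sizes is positive. That event concerns phase-II
  data only, whereas the sample sizes are a function of phase-I data, so the probabilities multiply.
\<close>
lemma prob_false_selection_decomp:
  assumes \<alpha>0: "\<alpha>0 \<in> {0<..<1}" and C [measurable]: "C \<in> sets borel"
    and S: "S = {..Suc T} \<times> {..Suc T}"
    and E: "E = (\<lambda>(a, b). {q. q \<in> C \<and> allocation \<alpha>0 T 1 q = a \<and> allocation \<alpha>0 T 2 q = b})"
  shows "prob {\<omega> \<in> space M. p_est \<alpha>0 T \<omega> \<in> C} = (\<Sum>s\<in>S. prob {\<omega> \<in> space M. p_est \<alpha>0 T \<omega> \<in> E s})"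
    and "prob {\<omega> \<in> space M. p_est \<alpha>0 T \<omega> \<in> C \<and> false_selection \<alpha>0 T \<omega>}
      = (\<Sum>s\<in>S. prob {\<omega> \<in> space M. p_est \<alpha>0 T \<omega> \<in> E s} *
          prob {\<omega> \<in> space M. 0 < mean_gap (phase1_size \<alpha>0 T) (fst s) (snd s) \<omega>})"
    and "{\<omega> \<in> space M. p_est \<alpha>0 T \<omega> \<in> C \<and> false_selection \<alpha>0 T \<omega>} \<in> events"
proof -
  have [measurable]: "E s \<in> sets borel" for s
  proof (cases s)
    case (Pair a b)
    show ?thesis unfolding E Pair case_prod_conv by measurable
  qed
  note mean_gap_measurable [measurable]
  have inS: "(allocation \<alpha>0 T 1 (p_est \<alpha>0 T \<omega>), allocation \<alpha>0 T 2 (p_est \<alpha>0 T \<omega>)) \<in> S" for \<omega>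
    unfolding S p_est_def using allocation_bounds(4)[OF p_hat_range \<alpha>0] by auto
  have finS: "finite S" by (simp add: S)
  have U1: "{\<omega> \<in> space M. p_est \<alpha>0 T \<omega> \<in> C} = (\<Union>s\<in>S. {\<omega> \<in> space M. p_est \<alpha>0 T \<omega> \<in> E s})"
    using inS by (auto simp: E)
  show "prob {\<omega> \<in> space M. p_est \<alpha>0 T \<omega> \<in> C} = (\<Sum>s\<in>S. prob {\<omega> \<in> space M. p_est \<alpha>0 T \<omega> \<in> E s})"
    unfolding U1 by (rule finite_measure_finite_Union[OF finS]) (auto simp: E disjoint_family_on_def)
  have U2: "{\<omega> \<in> space M. p_est \<alpha>0 T \<omega> \<in> C \<and> false_selection \<alpha>0 T \<omega>}
     = (\<Union>s\<in>S. {\<omega> \<in> space M. p_est \<alpha>0 T \<omega> \<in> E s \<and> mean_gap (phase1_size \<alpha>0 T) (fst s) (snd s) \<omega> \<in> {0<..}})" (is "?L = ?R")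
  proof (intro equalityI subsetI)
    fix \<omega> assume "\<omega> \<in> ?L"
    then show "\<omega> \<in> ?R" by (intro UN_I[OF inS[of \<omega>]]) (simp add: E false_selection_iff)
  next
    fix \<omega> assume "\<omega> \<in> ?R"
    then obtain a b where "\<omega> \<in> space M" "p_est \<alpha>0 T \<omega> \<in> E (a, b)" "0 < mean_gap (phase1_size \<alpha>0 T) a b \<omega>" by auto
    then show "\<omega> \<in> ?L" by (auto simp: E false_selection_iff)
  qed
  have ev: "{\<omega> \<in> space M. p_est \<alpha>0 T \<omega> \<in> E s \<and> mean_gap (phase1_size \<alpha>0 T) (fst s) (snd s) \<omega> \<in> {0<..}} \<in> events" for s
    by measurable
  show "{\<omega> \<in> space M. p_est \<alpha>0 T \<omega> \<in> C \<and> false_selection \<alpha>0 T \<omega>} \<in> events"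
    unfolding U2 using finS ev by auto
  have "prob {\<omega> \<in> space M. p_est \<alpha>0 T \<omega> \<in> C \<and> false_selection \<alpha>0 T \<omega>}
     = (\<Sum>s\<in>S. prob {\<omega> \<in> space M. p_est \<alpha>0 T \<omega> \<in> E s \<and> mean_gap (phase1_size \<alpha>0 T) (fst s) (snd s) \<omega> \<in> {0<..}})"
    unfolding U2 by (rule finite_measure_finite_Union[OF finS]) (use ev in \<open>auto simp: E disjoint_family_on_def\<close>)
  also have "\<dots> = (\<Sum>s\<in>S. prob {\<omega> \<in> space M. p_est \<alpha>0 T \<omega> \<in> E s} *
          prob {\<omega> \<in> space M. 0 < mean_gap (phase1_size \<alpha>0 T) (fst s) (snd s) \<omega>})"
    by (intro sum.cong refl) (subst prob_indep_random_variable[OF indep_p_est_mean_gap], auto)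
  finally show "prob {\<omega> \<in> space M. p_est \<alpha>0 T \<omega> \<in> C \<and> false_selection \<alpha>0 T \<omega>}
      = (\<Sum>s\<in>S. prob {\<omega> \<in> space M. p_est \<alpha>0 T \<omega> \<in> E s} *
          prob {\<omega> \<in> space M. 0 < mean_gap (phase1_size \<alpha>0 T) (fst s) (snd s) \<omega>})" .
qed

lemma prob_false_selection_le:
  assumes \<alpha>0: "\<alpha>0 \<in> {0<..<1}" and C: "C \<in> sets borel"
    and le: "\<And>q. q \<in> C \<Longrightarrow> q \<in> {0..1} \<Longrightarrow>
      prob {\<omega> \<in> space M. 0 < mean_gap (phase1_size \<alpha>0 T) (allocation \<alpha>0 T 1 q) (allocation \<alpha>0 T 2 q) \<omega>} \<le> c"
  shows "prob {\<omega> \<in> space M. p_est \<alpha>0 T \<omega> \<in> C \<and> false_selection \<alpha>0 T \<omega>} \<le> c * prob {\<omega> \<in> space M. p_est \<alpha>0 T \<omega> \<in> C}"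
  unfolding prob_false_selection_decomp[OF \<alpha>0 C refl refl] sum_distrib_left
proof (rule sum_mono, clarify, unfold case_prod_conv fst_conv snd_conv)
  fix a b
  let ?A = "{\<omega> \<in> space M. p_est \<alpha>0 T \<omega> \<in> {q. q \<in> C \<and> allocation \<alpha>0 T 1 q = a \<and> allocation \<alpha>0 T 2 q = b}}"
  let ?B = "{\<omega> \<in> space M. 0 < mean_gap (phase1_size \<alpha>0 T) a b \<omega>}"
  show "prob ?A * prob ?B \<le> c * prob ?A"
  proof (cases "?A = {}")
    case False
    then obtain \<omega> where \<omega>: "p_est \<alpha>0 T \<omega> \<in> C" "allocation \<alpha>0 T 1 (p_est \<alpha>0 T \<omega>) = a"
        "allocation \<alpha>0 T 2 (p_est \<alpha>0 T \<omega>) = b" by blast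
    have "p_est \<alpha>0 T \<omega> \<in> {0..1}" unfolding p_est_def by (rule p_hat_range)
    from le[OF \<omega>(1) this] have "prob ?B \<le> c" unfolding \<omega>(2,3) .
    then show ?thesis by (simp add: mult.commute mult_right_mono)
  qed (simp only: measure_empty)
qed

lemma prob_false_selection_ge:
  assumes \<alpha>0: "\<alpha>0 \<in> {0<..<1}" and C: "C \<in> sets borel"
    and ge: "\<And>q. q \<in> C \<Longrightarrow> q \<in> {0..1} \<Longrightarrow>
      c \<le> prob {\<omega> \<in> space M. 0 < mean_gap (phase1_size \<alpha>0 T) (allocation \<alpha>0 T 1 q) (allocation \<alpha>0 T 2 q) \<omega>}"
  shows "c * prob {\<omega> \<in> space M. p_est \<alpha>0 T \<omega> \<in> C} \<le> prob {\<omega> \<in> space M. p_est \<alpha>0 T \<omega> \<in> C \<and> false_selection \<alpha>0 T \<omega>}"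
  unfolding prob_false_selection_decomp[OF \<alpha>0 C refl refl] sum_distrib_left
proof (rule sum_mono, clarify, unfold case_prod_conv fst_conv snd_conv)
  fix a b
  let ?A = "{\<omega> \<in> space M. p_est \<alpha>0 T \<omega> \<in> {q. q \<in> C \<and> allocation \<alpha>0 T 1 q = a \<and> allocation \<alpha>0 T 2 q = b}}"
  let ?B = "{\<omega> \<in> space M. 0 < mean_gap (phase1_size \<alpha>0 T) a b \<omega>}"
  show "c * prob ?A \<le> prob ?A * prob ?B"
  proof (cases "?A = {}")
    case False
    then obtain \<omega> where \<omega>: "p_est \<alpha>0 T \<omega> \<in> C" "allocation \<alpha>0 T 1 (p_est \<alpha>0 T \<omega>) = a"
        "allocation \<alpha>0 T 2 (p_est \<alpha>0 T \<omega>) = b" by blast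
    have "p_est \<alpha>0 T \<omega> \<in> {0..1}" unfolding p_est_def by (rule p_hat_range)
    from ge[OF \<omega>(1) this] have "c \<le> prob ?B" unfolding \<omega>(2,3) .
    then show ?thesis by (simp add: mult.commute mult_right_mono)
  qed (simp only: measure_empty)
qed

end

section \<open>The rate function and its minimiser\<close>

text \<open>
  The first summand of the objective with the fractions cleared. In this form it is continuous on
  the closed unit interval, with value \<open>0\<close> at both ends.
\<close>
definition selection_exponent :: "real \<Rightarrow> real \<Rightarrow> real \<Rightarrow> real \<Rightarrow> real \<Rightarrow> real" where
  "selection_exponent \<alpha>0 \<delta> \<sigma>1 \<sigma>2 q = (1 - \<alpha>0) * \<delta>\<^sup>2 / 2 * (q * (1 - q) / (\<sigma>1\<^sup>2 * (1 - q) + \<sigma>2\<^sup>2 * q))"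

text \<open>
  The quotient of the arithmetic and the geometric mean of \<open>((1 - q) \<sigma>1)\<^sup>2\<close> and \<open>(q \<sigma>2)\<^sup>2\<close>. It equals
  \<open>1\<close> exactly when \<open>q\<close> is the true fraction \<open>\<sigma>1 / (\<sigma>1 + \<sigma>2)\<close>.
\<close>
definition imbalance :: "real \<Rightarrow> real \<Rightarrow> real \<Rightarrow> real" where
  "imbalance \<sigma>1 \<sigma>2 q = ((1 - q)\<^sup>2 * \<sigma>1\<^sup>2 + q\<^sup>2 * \<sigma>2\<^sup>2) / (2 * q * (1 - q) * \<sigma>1 * \<sigma>2)"

lemma selection_exponent_eq:
  assumes "q \<in> {0<..<1}" "\<sigma>1 > 0" "\<sigma>2 > 0"
  shows "selection_exponent \<alpha>0 \<delta> \<sigma>1 \<sigma>2 q = (1 - \<alpha>0) * \<delta>\<^sup>2 / (2 * (\<sigma>1\<^sup>2 / q + \<sigma>2\<^sup>2 / (1 - q)))"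
proof -
  have "\<sigma>1\<^sup>2 / q + \<sigma>2\<^sup>2 / (1 - q) = (\<sigma>1\<^sup>2 * (1 - q) + \<sigma>2\<^sup>2 * q) / (q * (1 - q))"
    using assms by (simp add: field_simps)
  then show ?thesis by (simp add: selection_exponent_def)
qed

lemma rate_objective_interior:
  assumes "q \<in> {0<..<1}" "\<sigma>1 > 0" "\<sigma>2 > 0"
  shows "rate_objective \<alpha>0 \<delta> \<sigma>1 \<sigma>2 q
    = ereal (selection_exponent \<alpha>0 \<delta> \<sigma>1 \<sigma>2 q + \<alpha>0 / 2 * ln (imbalance \<sigma>1 \<sigma>2 q))"
  using assms by (simp add: rate_objective_def selection_exponent_eq imbalance_def)

lemma selection_denominator_pos:
  fixes q \<sigma>1 \<sigma>2 :: real
  assumes "q \<in> {0..1}" "\<sigma>1 > 0" "\<sigma>2 > 0"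
  shows "\<sigma>1\<^sup>2 * (1 - q) + \<sigma>2\<^sup>2 * q > 0"
  using assms by (cases "q = 0") (auto intro!: add_nonneg_pos)

lemma selection_exponent_nonneg:
  assumes "q \<in> {0..1}" "\<sigma>1 > 0" "\<sigma>2 > 0" "\<alpha>0 \<in> {0<..<1}"
  shows "0 \<le> selection_exponent \<alpha>0 \<delta> \<sigma>1 \<sigma>2 q"
  using selection_denominator_pos[OF assms(1-3)] assms by (simp add: selection_exponent_def)

lemma continuous_on_selection_exponent:
  assumes "\<sigma>1 > 0" "\<sigma>2 > 0"
  shows "continuous_on {0..1} (selection_exponent \<alpha>0 \<delta> \<sigma>1 \<sigma>2)"
  unfolding selection_exponent_def[abs_def]
  using selection_denominator_pos[OF _ assms] by (intro continuous_intros) (force simp: less_le)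

lemma one_le_imbalance:
  assumes "q \<in> {0<..<1}" "\<sigma>1 > 0" "\<sigma>2 > 0"
  shows "1 \<le> imbalance \<sigma>1 \<sigma>2 q"
proof -
  have "0 \<le> ((1 - q) * \<sigma>1 - q * \<sigma>2)\<^sup>2" by simp
  then have "2 * q * (1 - q) * \<sigma>1 * \<sigma>2 \<le> (1 - q)\<^sup>2 * \<sigma>1\<^sup>2 + q\<^sup>2 * \<sigma>2\<^sup>2"
    by (simp add: power2_diff power_mult_distrib mult_ac)
  then show ?thesis using assms by (simp add: imbalance_def le_divide_eq)
qed

lemma imbalance_balanced:
  assumes "\<sigma>1 > 0" "\<sigma>2 > 0"
  shows "imbalance \<sigma>1 \<sigma>2 (\<sigma>1 / (\<sigma>1 + \<sigma>2)) = 1"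
proof -
  define d where "d = \<sigma>1 + \<sigma>2"
  have d: "d > 0" "1 - \<sigma>1 / d = \<sigma>2 / d" using assms by (simp_all add: d_def field_simps)
  show ?thesis unfolding d_def[symmetric] imbalance_def d(2)
    using assms d(1) by (simp add: field_simps power2_eq_square)
qed

lemma imbalance_eq_left:
  assumes "q \<in> {0<..<1}" "\<sigma>1 > 0" "\<sigma>2 > 0"
  shows "imbalance \<sigma>1 \<sigma>2 q = (\<sigma>1\<^sup>2 + (q / (1 - q))\<^sup>2 * \<sigma>2\<^sup>2) / (2 * (q / (1 - q)) * \<sigma>1 * \<sigma>2)"
proof -
  have "(\<sigma>1\<^sup>2 + (q / (1 - q))\<^sup>2 * \<sigma>2\<^sup>2) = ((1 - q)\<^sup>2 * \<sigma>1\<^sup>2 + q\<^sup>2 * \<sigma>2\<^sup>2) / (1 - q)\<^sup>2"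
    using assms by (simp add: power_divide add_divide_distrib)
  moreover have "2 * (q / (1 - q)) * \<sigma>1 * \<sigma>2 = 2 * q * (1 - q) * \<sigma>1 * \<sigma>2 / (1 - q)\<^sup>2"
    using assms by (simp add: power2_eq_square)
  ultimately show ?thesis using assms by (simp add: imbalance_def)
qed

lemma imbalance_flip: "imbalance \<sigma>2 \<sigma>1 (1 - q) = imbalance \<sigma>1 \<sigma>2 q"
  by (simp add: imbalance_def mult_ac add.commute)

lemma imbalance_at_top:
  assumes "\<sigma>1 > 0" "\<sigma>2 > 0"
  shows "filterlim (imbalance \<sigma>1 \<sigma>2) at_top (at_right 0)" "filterlim (imbalance \<sigma>1 \<sigma>2) at_top (at_left 1)"
  unfolding imbalance_def[abs_def] using assms by real_asymp+

text \<open>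
  The imbalance tends to infinity at both ends of the unit interval, so that near the ends the
  objective exceeds its value at the true fraction \<open>p0\<close>. Away from the ends compactness applies.
\<close>
lemma rate_minimizer:
  assumes \<sigma>: "\<sigma>1 > 0" "\<sigma>2 > 0" and \<alpha>0: "\<alpha>0 \<in> {0<..<1}"
    and f: "f = (\<lambda>q. selection_exponent \<alpha>0 \<delta> \<sigma>1 \<sigma>2 q + \<alpha>0 / 2 * ln (imbalance \<sigma>1 \<sigma>2 q))"
  obtains p where "p \<in> {0<..<1}" "\<And>q. q \<in> {0<..<1} \<Longrightarrow> f p \<le> f q"
proof -
  define p0 where "p0 = \<sigma>1 / (\<sigma>1 + \<sigma>2)"
  have p0: "p0 \<in> {0<..<1}" using \<sigma> by (simp add: p0_def)
  define B where "B = exp (2 * f p0 / \<alpha>0)"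
  have big: "f p0 < f q" if "q \<in> {0<..<1}" "B < imbalance \<sigma>1 \<sigma>2 q" for q
  proof -
    have "ln B < ln (imbalance \<sigma>1 \<sigma>2 q)" using that by (intro ln_strict_mono) (auto simp: B_def)
    then have "\<alpha>0 / 2 * ln B < \<alpha>0 / 2 * ln (imbalance \<sigma>1 \<sigma>2 q)" using \<alpha>0 by (intro mult_strict_left_mono) auto
    moreover have "\<alpha>0 / 2 * ln B = f p0" using \<alpha>0 by (simp add: B_def)
    moreover have "0 \<le> selection_exponent \<alpha>0 \<delta> \<sigma>1 \<sigma>2 q" using selection_exponent_nonneg[OF _ \<sigma> \<alpha>0] that by simp
    ultimately show ?thesis by (simp add: f)
  qed
  have "eventually (\<lambda>q. B < imbalance \<sigma>1 \<sigma>2 q) (at_right 0)" "eventually (\<lambda>q. B < imbalance \<sigma>1 \<sigma>2 q) (at_left 1)"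
    using imbalance_at_top[OF \<sigma>] by (auto simp: filterlim_at_top_dense)
  then obtain l u where l: "l > 0" "\<And>q. q > 0 \<Longrightarrow> q < l \<Longrightarrow> B < imbalance \<sigma>1 \<sigma>2 q"
    and u: "u < 1" "\<And>q. q > u \<Longrightarrow> q < 1 \<Longrightarrow> B < imbalance \<sigma>1 \<sigma>2 q"
    unfolding eventually_at_right_field eventually_at_left_field by blast
  have lu: "l \<le> p0" "p0 \<le> u" using l(2)[of p0] u(2)[of p0] big[OF p0] p0 by force+
  have sub: "{l..u} \<subseteq> {0<..<1}" using l(1) u(1) by auto
  have "continuous_on {l..u} (imbalance \<sigma>1 \<sigma>2)"
    unfolding imbalance_def[abs_def] using sub \<sigma> by (intro continuous_intros) auto
  moreover have "imbalance \<sigma>1 \<sigma>2 q > 0" if "q \<in> {l..u}" for q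
    using one_le_imbalance[OF _ \<sigma>, of q] that sub by fastforce
  ultimately have "continuous_on {l..u} f"
    unfolding f using sub
    by (intro continuous_intros continuous_on_subset[OF continuous_on_selection_exponent[OF \<sigma>]]) force+
  then obtain p where p: "p \<in> {l..u}" "\<And>q. q \<in> {l..u} \<Longrightarrow> f p \<le> f q"
    using continuous_attains_inf[of "{l..u}" f] lu by auto
  have "f p \<le> f q" if "q \<in> {0<..<1}" for q
  proof (cases "q \<in> {l..u}")
    case False
    then have "B < imbalance \<sigma>1 \<sigma>2 q" using l(2)[of q] u(2)[of q] that by auto
    then have "f p0 < f q" using big that by blast
    moreover have "f p \<le> f p0" using p(2) lu by auto
    ultimately show ?thesis by simp
  qed (use p in auto)
  with that p(1) sub show ?thesis by blast
qed

section \<open>Upper bound for the probability of false selection\<close>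

lemma phase1_size_bounds:
  assumes "\<alpha>0 \<in> {0<..<1}"
  shows "\<alpha>0 * real T / 2 - 1 < real (phase1_size \<alpha>0 T)" "real (phase1_size \<alpha>0 T) \<le> \<alpha>0 * real T / 2"
proof -
  have "0 \<le> \<alpha>0 * real T / 2" using assms by simp
  then show "\<alpha>0 * real T / 2 - 1 < real (phase1_size \<alpha>0 T)" "real (phase1_size \<alpha>0 T) \<le> \<alpha>0 * real T / 2"
    unfolding phase1_size_def by linarith+
qed

lemma filterlim_phase1_size:
  assumes "\<alpha>0 \<in> {0<..<1}"
  shows "filterlim (phase1_size \<alpha>0) at_top sequentially"
proof -
  have "filterlim (\<lambda>T. \<alpha>0 * real T / 2 - 1) at_top sequentially" using assms by real_asymp
  then have "filterlim (\<lambda>T. real (phase1_size \<alpha>0 T)) at_top sequentially"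
    by (rule filterlim_at_top_mono) (use phase1_size_bounds[OF assms] in \<open>auto intro!: always_eventually less_imp_le\<close>)
  then show ?thesis by (simp add: filterlim_sequentially_iff_filterlim_real)
qed

locale two_phase = gaussian_pair +
  fixes \<delta> \<alpha>0 :: real
  assumes \<delta>: "\<delta> = \<mu> 1 - \<mu> 2" "\<delta> > 0" and \<alpha>0: "\<alpha>0 \<in> {0<..<1}"
begin

abbreviation "G \<equiv> selection_exponent \<alpha>0 \<delta> (\<sigma> 1) (\<sigma> 2)"
abbreviation "R \<equiv> imbalance (\<sigma> 1) (\<sigma> 2)"

lemma sigmas: "\<sigma> 1 > 0" "\<sigma> 2 > 0"
  using sigma_pos by auto

text \<open>
  The sample size \<open>\<lfloor>x\<rfloor> + 1\<close> exceeds \<open>x\<close>, so rounding only reduces the variance of the difference and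
  the bound has the exact exponent for every budget.
\<close>
lemma prob_mean_gap_le:
  assumes q: "q \<in> {0..1}"
  shows "prob {\<omega> \<in> space M. 0 < mean_gap n (allocation \<alpha>0 T 1 q) (allocation \<alpha>0 T 2 q) \<omega>} \<le> exp (- (real T * G q))"
proof (cases "q = 0 \<or> q = 1 \<or> T = 0")
  case True
  then have zero: "real T * G q = 0" by (auto simp: selection_exponent_def)
  show ?thesis unfolding zero by simp
next
  case False
  then have q': "q \<in> {0<..<1}" and T: "real T > 0" using q by auto
  define a b where "a = allocation \<alpha>0 T 1 q" and "b = allocation \<alpha>0 T 2 q"
  define c where "c = (1 - \<alpha>0) * real T"
  have c: "c > 0" using \<alpha>0 T by (simp add: c_def)
  have ab: "a > 0" "b > 0" "c * q < real a" "c * (1 - q) < real b"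
    using allocation_bounds[OF q \<alpha>0, where i = 1 and T = T] allocation_bounds[OF q \<alpha>0, where i = 2 and T = T] by (auto simp: a_def b_def c_def mult_ac)
  define v where "v = (\<sigma> 1)\<^sup>2 / real a + (\<sigma> 2)\<^sup>2 / real b"
  have v: "v > 0" unfolding v_def using ab sigmas by (intro add_pos_pos) auto
  define w where "w = ((\<sigma> 1)\<^sup>2 / q + (\<sigma> 2)\<^sup>2 / (1 - q)) / c"
  have "v \<le> (\<sigma> 1)\<^sup>2 / (c * q) + (\<sigma> 2)\<^sup>2 / (c * (1 - q))"
    unfolding v_def using ab c q' by (intro add_mono divide_left_mono) (auto intro!: mult_pos_pos)
  also have "\<dots> = w" by (simp add: w_def add_divide_distrib mult.commute)
  finally have "v \<le> w" .
  have "real T * G q = \<delta>\<^sup>2 / (2 * w)"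
    unfolding selection_exponent_eq[OF q' sigmas] w_def c_def by simp
  also have "\<dots> \<le> \<delta>\<^sup>2 / (2 * v)"
    using \<open>v \<le> w\<close> v by (intro divide_left_mono mult_pos_pos) auto
  finally have exp_le: "exp (- (\<delta>\<^sup>2 / (2 * v))) \<le> exp (- (real T * G q))" by simp
  have "prob {\<omega> \<in> space M. 0 < mean_gap n a b \<omega>} \<le> exp (- (\<delta>\<^sup>2 / (2 * (sqrt v)\<^sup>2)))"
    using mean_gap_normal[OF ab(1,2), of n] \<delta> v unfolding v_def[symmetric]
    by (intro normal_prob_pos) auto
  also have "(sqrt v)\<^sup>2 = v" using v by simp
  also note exp_le
  finally show ?thesis unfolding a_def b_def .
qed

text \<open>
  An estimate of at most \<open>e\<close> means \<open>S1 \<le> e / (1 - e) * S2\<close>, an estimate of at least \<open>e\<close> means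
  \<open>S2 \<le> (1 - e) / e * S1\<close>. Both ratios lead to the same imbalance.
\<close>
lemma prob_p_est_tail_le:
  assumes e: "e \<in> {0<..<1}" and n: "2 \<le> phase1_size \<alpha>0 T"
  shows "e \<le> \<sigma> 1 / (\<sigma> 1 + \<sigma> 2) \<Longrightarrow> prob {\<omega> \<in> space M. p_est \<alpha>0 T \<omega> \<le> e} \<le> 2 / R e ^ (phase1_size \<alpha>0 T - 1)"
    and "\<sigma> 1 / (\<sigma> 1 + \<sigma> 2) \<le> e \<Longrightarrow> prob {\<omega> \<in> space M. e \<le> p_est \<alpha>0 T \<omega>} \<le> 2 / R e ^ (phase1_size \<alpha>0 T - 1)"
proof -
  define n where "n = phase1_size \<alpha>0 T"
  have n: "n > 0" "real n - 1 > 0" using n by (auto simp: n_def)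
  have [measurable]: "(\<lambda>\<omega>. sq_dev (\<lambda>k. X 1 k \<omega>) n) \<in> borel_measurable M" "(\<lambda>\<omega>. sq_dev (\<lambda>k. X 2 k \<omega>) n) \<in> borel_measurable M"
    using sq_dev_measurable by auto
  have sd_sq: "(sample_sd y n)\<^sup>2 * (real n - 1) = sq_dev y n" for y
    using n sq_dev_nonneg[of y n] by (simp add: sample_sd_eq)
  have sd_to_sq: "sq_dev y n \<le> r\<^sup>2 * sq_dev z n" if "sample_sd y n \<le> r * sample_sd z n" for y z r
  proof -
    have "(sample_sd y n)\<^sup>2 \<le> (r * sample_sd z n)\<^sup>2" using that sample_sd_nonneg by (intro power_mono) auto
    then have "(sample_sd y n)\<^sup>2 * (real n - 1) \<le> (r * sample_sd z n)\<^sup>2 * (real n - 1)" using n by (intro mult_right_mono) auto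
    then show ?thesis by (simp add: power_mult_distrib mult.assoc sd_sq)
  qed
  have est: "p_est \<alpha>0 T \<omega> = sample_sd (\<lambda>k. X 1 k \<omega>) n / (sample_sd (\<lambda>k. X 1 k \<omega>) n + sample_sd (\<lambda>k. X 2 k \<omega>) n)" for \<omega>
    by (simp add: p_est_def p_hat_def n_def)
  show "prob {\<omega> \<in> space M. p_est \<alpha>0 T \<omega> \<le> e} \<le> 2 / R e ^ (phase1_size \<alpha>0 T - 1)" if "e \<le> \<sigma> 1 / (\<sigma> 1 + \<sigma> 2)"
  proof -
    have r: "e / (1 - e) > 0" "e / (1 - e) * \<sigma> 2 \<le> \<sigma> 1"
      using that e sigmas by (auto simp: field_simps)
    have "prob {\<omega> \<in> space M. p_est \<alpha>0 T \<omega> \<le> e}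
        \<le> prob {\<omega> \<in> space M. sq_dev (\<lambda>k. X 1 k \<omega>) n \<le> (e / (1 - e))\<^sup>2 * sq_dev (\<lambda>k. X 2 k \<omega>) n}"
    proof (rule finite_measure_mono)
      show "{\<omega> \<in> space M. p_est \<alpha>0 T \<omega> \<le> e} \<subseteq> {\<omega> \<in> space M. sq_dev (\<lambda>k. X 1 k \<omega>) n \<le> (e / (1 - e))\<^sup>2 * sq_dev (\<lambda>k. X 2 k \<omega>) n}"
      proof safe
        fix \<omega> assume "p_est \<alpha>0 T \<omega> \<le> e"
        then have le: "x / (x + y) \<le> e" if "x = sample_sd (\<lambda>k. X 1 k \<omega>) n" "y = sample_sd (\<lambda>k. X 2 k \<omega>) n" for x y
          using that by (simp add: est)
        have "x \<le> e / (1 - e) * y" if "x = sample_sd (\<lambda>k. X 1 k \<omega>) n" "y = sample_sd (\<lambda>k. X 2 k \<omega>) n" for x y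
        proof (cases "x + y = 0")
          case True
          then have "x = 0" "y = 0" using that sample_sd_nonneg[of "\<lambda>k. X 1 k \<omega>" n] sample_sd_nonneg[of "\<lambda>k. X 2 k \<omega>" n] by linarith+
          then show ?thesis by simp
        next
          case False
          then have "x + y > 0" using that sample_sd_nonneg[of "\<lambda>k. X 1 k \<omega>" n] sample_sd_nonneg[of "\<lambda>k. X 2 k \<omega>" n] by linarith
          then have "x \<le> e * (x + y)" using le[OF that] by (simp add: divide_le_eq)
          then have "x * (1 - e) \<le> e * y" by (simp add: algebra_simps)
          then show ?thesis using e by (simp add: le_divide_eq)
        qed
        then show "sq_dev (\<lambda>k. X 1 k \<omega>) n \<le> (e / (1 - e))\<^sup>2 * sq_dev (\<lambda>k. X 2 k \<omega>) n" by (intro sd_to_sq) simp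
      qed
    qed measurable
    also have "\<dots> \<le> 2 / R e ^ (n - 1)"
      unfolding imbalance_eq_left[OF e sigmas] by (rule prob_sq_dev_ratio_le) (use n r in auto)
    finally show ?thesis by (simp add: n_def)
  qed
  show "prob {\<omega> \<in> space M. e \<le> p_est \<alpha>0 T \<omega>} \<le> 2 / R e ^ (phase1_size \<alpha>0 T - 1)" if "\<sigma> 1 / (\<sigma> 1 + \<sigma> 2) \<le> e"
  proof -
    have r: "(1 - e) / e > 0" "(1 - e) / e * \<sigma> 1 \<le> \<sigma> 2"
      using that e sigmas by (auto simp: field_simps)
    have "prob {\<omega> \<in> space M. e \<le> p_est \<alpha>0 T \<omega>}
        \<le> prob {\<omega> \<in> space M. sq_dev (\<lambda>k. X 2 k \<omega>) n \<le> ((1 - e) / e)\<^sup>2 * sq_dev (\<lambda>k. X 1 k \<omega>) n}"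
    proof (rule finite_measure_mono)
      show "{\<omega> \<in> space M. e \<le> p_est \<alpha>0 T \<omega>} \<subseteq> {\<omega> \<in> space M. sq_dev (\<lambda>k. X 2 k \<omega>) n \<le> ((1 - e) / e)\<^sup>2 * sq_dev (\<lambda>k. X 1 k \<omega>) n}"
      proof safe
        fix \<omega> assume "e \<le> p_est \<alpha>0 T \<omega>"
        then have le: "e \<le> x / (x + y)" if "x = sample_sd (\<lambda>k. X 1 k \<omega>) n" "y = sample_sd (\<lambda>k. X 2 k \<omega>) n" for x y
          using that by (simp add: est)
        have "y \<le> (1 - e) / e * x" if "x = sample_sd (\<lambda>k. X 1 k \<omega>) n" "y = sample_sd (\<lambda>k. X 2 k \<omega>) n" for x y
        proof -
          have "x + y \<noteq> 0" using le[OF that] e by auto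
          then have "x + y > 0" using that sample_sd_nonneg[of "\<lambda>k. X 1 k \<omega>" n] sample_sd_nonneg[of "\<lambda>k. X 2 k \<omega>" n] by linarith
          then have "e * (x + y) \<le> x" using le[OF that] by (simp add: le_divide_eq)
          then have "y * e \<le> (1 - e) * x" by (simp add: algebra_simps)
          then show ?thesis using e by (simp add: le_divide_eq)
        qed
        then show "sq_dev (\<lambda>k. X 2 k \<omega>) n \<le> ((1 - e) / e)\<^sup>2 * sq_dev (\<lambda>k. X 1 k \<omega>) n" by (intro sd_to_sq) simp
      qed
    qed measurable
    also have "\<dots> \<le> 2 / imbalance (\<sigma> 2) (\<sigma> 1) (1 - e) ^ (n - 1)"
    proof -
      have e': "1 - e \<in> {0<..<1}" and flip: "1 - (1 - e) = e" using e by auto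
      show ?thesis
        unfolding imbalance_eq_left[OF e' sigmas(2,1)] flip by (rule prob_sq_dev_ratio_le) (use n r in auto)
    qed
    finally show ?thesis by (simp add: n_def imbalance_flip)
  qed
qed

text \<open>
  The point \<open>e\<close> of the cell that is closest to the true fraction determines the phase-I cost of
  reaching the cell. The phase-II exponent at \<open>e\<close> is that of any other point of the cell up to \<open>\<eta>\<close>,
  so the two costs add up to the objective at the single point \<open>e\<close>.
\<close>
lemma prob_cell_le:
  assumes uv: "0 \<le> u" "u < v" "v \<le> 1"
    and osc: "\<And>x y. x \<in> {u..v} \<Longrightarrow> y \<in> {u..v} \<Longrightarrow> G x \<le> G y + \<eta>"
    and F: "\<And>q. q \<in> {0<..<1} \<Longrightarrow> F \<le> G q + \<alpha>0 / 2 * ln (R q)"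
  shows "\<exists>K. \<forall>T. 2 \<le> phase1_size \<alpha>0 T \<longrightarrow>
    prob {\<omega> \<in> space M. p_est \<alpha>0 T \<omega> \<in> {u..v} \<and> false_selection \<alpha>0 T \<omega>} \<le> K * exp (- (real T * (F - \<eta>)))"
proof -
  define p0 where "p0 = \<sigma> 1 / (\<sigma> 1 + \<sigma> 2)"
  have p0: "p0 \<in> {0<..<1}" using sigmas by (simp add: p0_def)
  define e where "e = (if v \<le> p0 then v else if p0 \<le> u then u else p0)"
  have e: "e \<in> {0<..<1}" "e \<in> {u..v}" using uv p0 by (auto simp: e_def)
  have R1: "R e \<ge> 1" using one_le_imbalance[OF e(1) sigmas] .
  have "prob {\<omega> \<in> space M. p_est \<alpha>0 T \<omega> \<in> {u..v} \<and> false_selection \<alpha>0 T \<omega>}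
      \<le> 2 * (R e)\<^sup>2 * exp (- (real T * (F - \<eta>)))" if T: "2 \<le> phase1_size \<alpha>0 T" for T
  proof -
    define n where "n = phase1_size \<alpha>0 T"
    have p: "prob {\<omega> \<in> space M. p_est \<alpha>0 T \<omega> \<in> {u..v}} \<le> 2 / R e ^ (n - 1)"
    proof -
      consider "v \<le> p0" | "p0 \<le> u" | "e = p0" using e_def by fastforce
      then show ?thesis
      proof cases
        case 1
        then have "prob {\<omega> \<in> space M. p_est \<alpha>0 T \<omega> \<in> {u..v}} \<le> prob {\<omega> \<in> space M. p_est \<alpha>0 T \<omega> \<le> e}"
          by (intro finite_measure_mono) (auto simp: e_def)
        also have "\<dots> \<le> 2 / R e ^ (n - 1)"
          unfolding n_def by (rule prob_p_est_tail_le[OF e(1) T]) (use 1 in \<open>simp add: e_def p0_def\<close>)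
        finally show ?thesis .
      next
        case 2
        then have "e = u" using uv by (auto simp: e_def)
        have "prob {\<omega> \<in> space M. p_est \<alpha>0 T \<omega> \<in> {u..v}} \<le> prob {\<omega> \<in> space M. e \<le> p_est \<alpha>0 T \<omega>}"
          by (intro finite_measure_mono) (auto simp: \<open>e = u\<close>)
        also have "\<dots> \<le> 2 / R e ^ (n - 1)"
          unfolding n_def by (rule prob_p_est_tail_le[OF e(1) T]) (use 2 in \<open>simp add: \<open>e = u\<close> p0_def\<close>)
        finally show ?thesis .
      next
        case 3
        have R_e: "R e = 1" unfolding 3 p0_def by (rule imbalance_balanced[OF sigmas])
        show ?thesis unfolding R_e by (rule order_trans[OF prob_le_1]) simp
      qed
    qed
    \<comment> \<open>Rounding down the phase-I size and the power \<open>n - 1\<close> lose at most one factor \<open>R e\<close> each.\<close>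
    have Rn: "1 / R e ^ (n - 1) \<le> (R e)\<^sup>2 * exp (- (real T * (\<alpha>0 / 2 * ln (R e))))"
    proof -
      have "R e ^ (n - 1) = exp (real (n - 1) * ln (R e))" using R1 by (simp add: exp_of_nat_mult)
      then have "1 / R e ^ (n - 1) = exp (- (real (n - 1) * ln (R e)))" by (simp add: exp_minus inverse_eq_divide)
      also have "\<dots> \<le> exp (2 * ln (R e) - real T * (\<alpha>0 / 2 * ln (R e)))"
      proof -
        have "\<alpha>0 * real T / 2 - 2 \<le> real (n - 1)" using phase1_size_bounds(1)[OF \<alpha>0, of T] T by (simp add: n_def)
        then have "(\<alpha>0 * real T / 2 - 2) * ln (R e) \<le> real (n - 1) * ln (R e)" using R1 by (intro mult_right_mono) auto
        then show ?thesis by (simp add: algebra_simps)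
      qed
      also have "\<dots> = (R e)\<^sup>2 * exp (- (real T * (\<alpha>0 / 2 * ln (R e))))"
        using R1 exp_of_nat_mult[of 2 "ln (R e)"] by (simp add: exp_diff exp_minus inverse_eq_divide)
      finally show ?thesis .
    qed
    have "prob {\<omega> \<in> space M. p_est \<alpha>0 T \<omega> \<in> {u..v} \<and> false_selection \<alpha>0 T \<omega>}
       \<le> exp (- (real T * (G e - \<eta>))) * prob {\<omega> \<in> space M. p_est \<alpha>0 T \<omega> \<in> {u..v}}"
    proof (rule prob_false_selection_le[OF \<alpha>0])
      fix q assume q: "q \<in> {u..v}" "q \<in> {0..1}"
      have "G e - \<eta> \<le> G q" using osc[OF e(2) q(1)] by simp
      then have "exp (- (real T * G q)) \<le> exp (- (real T * (G e - \<eta>)))" by (simp add: mult_left_mono)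
      then show "prob {\<omega> \<in> space M. 0 < mean_gap (phase1_size \<alpha>0 T) (allocation \<alpha>0 T 1 q) (allocation \<alpha>0 T 2 q) \<omega>}
          \<le> exp (- (real T * (G e - \<eta>)))"
        using prob_mean_gap_le[OF q(2)] by (rule order_trans[rotated])
    qed simp
    also have "\<dots> \<le> exp (- (real T * (G e - \<eta>))) * (2 * ((R e)\<^sup>2 * exp (- (real T * (\<alpha>0 / 2 * ln (R e))))))"
      using p Rn by (intro mult_left_mono) auto
    also have "\<dots> = 2 * (R e)\<^sup>2 * exp (- (real T * (G e + \<alpha>0 / 2 * ln (R e) - \<eta>)))"
      by (simp add: exp_add[symmetric] algebra_simps)
    also have "\<dots> \<le> 2 * (R e)\<^sup>2 * exp (- (real T * (F - \<eta>)))"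
      using F[OF e(1)] by (intro mult_left_mono) (auto intro!: mult_left_mono)
    finally show ?thesis .
  qed
  then show ?thesis by blast
qed

lemma PFS_upper:
  assumes F: "\<And>q. q \<in> {0<..<1} \<Longrightarrow> F \<le> G q + \<alpha>0 / 2 * ln (R q)" and \<eta>: "\<eta> > 0"
  shows "eventually (\<lambda>T. PFS M X \<alpha>0 T \<le> exp (- (real T * (F - \<eta>)))) sequentially"
proof -
  have uc: "uniformly_continuous_on {0..1} G"
    by (intro compact_uniformly_continuous continuous_on_selection_exponent sigmas) auto
  \<comment> \<open>Half of \<open>\<eta>\<close> pays for the oscillation of \<open>G\<close> within a cell, the other half for the constants.\<close>
  obtain d where d: "d > 0" "\<And>x y. x \<in> {0..1} \<Longrightarrow> y \<in> {0..1} \<Longrightarrow> dist y x < d \<Longrightarrow> dist (G y) (G x) < \<eta> / 2"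
    using uniformly_continuous_onE[OF uc half_gt_zero[OF \<eta>]] by blast
  obtain m where m: "m > 0" "1 / real m < d"
    using ex_inverse_of_nat_less[OF d(1)] by (auto simp: inverse_eq_divide)
  define cell where "cell j = {real j / real m .. real (Suc j) / real m}" for j
  have "\<exists>K. \<forall>T. 2 \<le> phase1_size \<alpha>0 T \<longrightarrow>
      prob {\<omega> \<in> space M. p_est \<alpha>0 T \<omega> \<in> cell j \<and> false_selection \<alpha>0 T \<omega>} \<le> K * exp (- (real T * (F - \<eta> / 2)))" if "j < m" for j
  proof -
    have bd: "0 \<le> real j / real m" "real j / real m < real (Suc j) / real m" "real (Suc j) / real m \<le> 1"
      using that m by (auto simp: field_simps)
    have "G x \<le> G y + \<eta> / 2" if xy: "x \<in> cell j" "y \<in> cell j" for x y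
    proof -
      have "\<bar>x - y\<bar> \<le> real (Suc j) / real m - real j / real m" using xy unfolding cell_def by auto
      also have "\<dots> = 1 / real m" by (simp add: diff_divide_distrib[symmetric])
      finally have "dist x y < d" using m by (simp add: dist_real_def)
      moreover have "x \<in> {0..1}" "y \<in> {0..1}" using xy bd(1,3) unfolding cell_def atLeastAtMost_iff by linarith+
      ultimately have "dist (G x) (G y) < \<eta> / 2" using d by blast
      then have "\<bar>G x - G y\<bar> < \<eta> / 2" by (simp only: dist_real_def)
      then show ?thesis by linarith
    qed
    from prob_cell_le[OF bd this[unfolded cell_def] F] show ?thesis unfolding cell_def .
  qed
  then have "\<forall>j\<in>{..<m}. \<exists>K. \<forall>T. 2 \<le> phase1_size \<alpha>0 T \<longrightarrow>
      prob {\<omega> \<in> space M. p_est \<alpha>0 T \<omega> \<in> cell j \<and> false_selection \<alpha>0 T \<omega>} \<le> K * exp (- (real T * (F - \<eta> / 2)))"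
    by blast
  from bchoice[OF this] obtain K where K: "\<forall>j\<in>{..<m}. \<forall>T. 2 \<le> phase1_size \<alpha>0 T \<longrightarrow>
      prob {\<omega> \<in> space M. p_est \<alpha>0 T \<omega> \<in> cell j \<and> false_selection \<alpha>0 T \<omega>} \<le> K j * exp (- (real T * (F - \<eta> / 2)))"
    by blast
  define K' where "K' = (\<Sum>j<m. K j)"
  have "eventually (\<lambda>T. K' \<le> exp (real T * (\<eta> / 2))) sequentially"
  proof -
    have "filterlim (\<lambda>T. exp (real T * (\<eta> / 2))) at_top sequentially" using \<eta> by real_asymp
    then show ?thesis by (auto simp: filterlim_at_top)
  qed
  moreover have "eventually (\<lambda>T. 2 \<le> phase1_size \<alpha>0 T) sequentially"
    using filterlim_phase1_size[OF \<alpha>0] by (auto simp: filterlim_at_top)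
  ultimately show ?thesis
  proof eventually_elim
    case (elim T)
    define E where "E j = {\<omega> \<in> space M. p_est \<alpha>0 T \<omega> \<in> cell j \<and> false_selection \<alpha>0 T \<omega>}" for j
    have Eev: "E j \<in> events" for j
      unfolding E_def by (rule prob_false_selection_decomp(3)[OF \<alpha>0 _ refl refl]) (simp add: cell_def)
    have "{\<omega> \<in> space M. false_selection \<alpha>0 T \<omega>} \<subseteq> (\<Union>j<m. E j)"
    proof safe
      fix \<omega> assume \<omega>: "\<omega> \<in> space M" "false_selection \<alpha>0 T \<omega>"
      define q where "q = p_est \<alpha>0 T \<omega>"
      have q: "0 \<le> q" "q \<le> 1" using p_hat_range[of \<alpha>0 T "\<lambda>i k. X i k \<omega>"] by (auto simp: q_def p_est_def)
      have "\<exists>j<m. q \<in> cell j"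
      proof (cases "q = 1")
        case True
        then show ?thesis using m by (intro exI[of _ "m - 1"]) (auto simp: cell_def field_simps)
      next
        case False
        define j where "j = nat \<lfloor>q * real m\<rfloor>"
        have "0 \<le> q * real m" "q * real m < real m" using q False m by auto
        then have "real j \<le> q * real m" "q * real m < real j + 1" "j < m" unfolding j_def by linarith+
        then show ?thesis using m by (intro exI[of _ j]) (auto simp: cell_def field_simps)
      qed
      then show "\<omega> \<in> (\<Union>j<m. E j)" using \<omega> by (auto simp: E_def q_def)
    qed
    then have "PFS M X \<alpha>0 T \<le> prob (\<Union>j<m. E j)"
      unfolding PFS_def false_selection_def[symmetric] using Eev by (intro finite_measure_mono) auto
    also have "\<dots> \<le> (\<Sum>j<m. prob (E j))" using Eev by (intro finite_measure_subadditive_finite) auto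
    also have "\<dots> \<le> (\<Sum>j<m. K j * exp (- (real T * (F - \<eta> / 2))))" using K elim by (intro sum_mono) (auto simp: E_def)
    also have "\<dots> = K' * exp (- (real T * (F - \<eta> / 2)))" by (simp add: K'_def sum_distrib_right)
    also have "\<dots> \<le> exp (real T * (\<eta> / 2)) * exp (- (real T * (F - \<eta> / 2)))" using elim by (intro mult_right_mono) auto
    also have "\<dots> = exp (- (real T * (F - \<eta>)))" by (simp add: exp_add[symmetric] algebra_simps)
    finally show ?case .
  qed
qed

end

section \<open>Lower bound for the probability of false selection\<close>

text \<open>
  All pairs \<open>(t p, t (1 - p))\<close> produce the estimate \<open>p\<close>. The sum of the two costs is smallest when the
  variances relative to the true ones have average \<open>1\<close>; this fixes \<open>t\<close>, makes the quadratic parts of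
  the rates cancel and leaves the logarithm.
\<close>
lemma tilt_rate_sum:
  assumes p: "p \<in> {0<..<1}" and \<sigma>: "\<sigma>1 > 0" "\<sigma>2 > 0"
    and t: "t = sqrt (2 / (p\<^sup>2 / \<sigma>1\<^sup>2 + (1 - p)\<^sup>2 / \<sigma>2\<^sup>2))"
  shows "t > 0" "tilt_rate \<sigma>1 (t * p) + tilt_rate \<sigma>2 (t * (1 - p)) = ln (imbalance \<sigma>1 \<sigma>2 p)"
proof -
  define A where "A = p\<^sup>2 / \<sigma>1\<^sup>2 + (1 - p)\<^sup>2 / \<sigma>2\<^sup>2"
  have A: "A > 0" unfolding A_def using p \<sigma> by (intro add_pos_pos) auto
  show tpos: "t > 0" using A by (simp add: t A_def[symmetric])
  have t2: "t\<^sup>2 = 2 / A" using A by (simp add: t A_def[symmetric])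
  have "(t * p)\<^sup>2 / \<sigma>1\<^sup>2 + (t * (1 - p))\<^sup>2 / \<sigma>2\<^sup>2 = t\<^sup>2 * A"
    by (simp add: A_def power_mult_distrib distrib_left)
  also have "\<dots> = 2" using A by (simp add: t2)
  finally have two: "(t * p)\<^sup>2 / \<sigma>1\<^sup>2 + (t * (1 - p))\<^sup>2 / \<sigma>2\<^sup>2 = 2" .
  have "(a - 1) / 2 + (b - 1) / 2 = 0" if "a + b = 2" for a b :: real
    using that by (simp add: field_simps)
  from this[OF two] have quad: "((t * p)\<^sup>2 / \<sigma>1\<^sup>2 - 1) / 2 + ((t * (1 - p))\<^sup>2 / \<sigma>2\<^sup>2 - 1) / 2 = 0" .
  have "ln (t * p / \<sigma>1) + ln (t * (1 - p) / \<sigma>2) = ln ((t * p / \<sigma>1) * (t * (1 - p) / \<sigma>2))"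
    using tpos p \<sigma> by (intro ln_mult_pos[symmetric]) auto
  also have "(t * p / \<sigma>1) * (t * (1 - p) / \<sigma>2) = t\<^sup>2 * (p * (1 - p) / (\<sigma>1 * \<sigma>2))"
    by (simp add: power2_eq_square)
  also have "\<dots> = 1 / imbalance \<sigma>1 \<sigma>2 p"
  proof -
    have "A = ((1 - p)\<^sup>2 * \<sigma>1\<^sup>2 + p\<^sup>2 * \<sigma>2\<^sup>2) / (\<sigma>1\<^sup>2 * \<sigma>2\<^sup>2)"
      using \<sigma> by (simp add: A_def field_simps)
    then have "t\<^sup>2 * (p * (1 - p) / (\<sigma>1 * \<sigma>2)) = 2 * (\<sigma>1\<^sup>2 * \<sigma>2\<^sup>2) * (p * (1 - p)) / (((1 - p)\<^sup>2 * \<sigma>1\<^sup>2 + p\<^sup>2 * \<sigma>2\<^sup>2) * (\<sigma>1 * \<sigma>2))"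
      by (simp add: t2)
    also have "2 * (\<sigma>1\<^sup>2 * \<sigma>2\<^sup>2) * (p * (1 - p)) = 2 * p * (1 - p) * \<sigma>1 * \<sigma>2 * (\<sigma>1 * \<sigma>2)"
      by (simp add: power2_eq_square mult_ac)
    finally show ?thesis using \<sigma> by (simp add: imbalance_def)
  qed
  also have "ln (1 / imbalance \<sigma>1 \<sigma>2 p) = - ln (imbalance \<sigma>1 \<sigma>2 p)"
    using one_le_imbalance[OF p \<sigma>] by (simp add: ln_div)
  finally show "tilt_rate \<sigma>1 (t * p) + tilt_rate \<sigma>2 (t * (1 - p)) = ln (imbalance \<sigma>1 \<sigma>2 p)"
    unfolding tilt_rate_def using quad by linarith
qed

context two_phase
begin

text \<open>
  It suffices that both sample deviations are close to the optimal pair. The two events are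
  independent, so their costs add.
\<close>
lemma prob_p_est_near_ge:
  assumes p: "p \<in> {0<..<1}" and \<epsilon>: "\<epsilon> > 0" and \<eta>: "\<eta> > 0"
  shows "eventually (\<lambda>T. exp (- (real T * (\<alpha>0 / 2 * ln (R p) + \<eta>)))
    \<le> prob {\<omega> \<in> space M. p_est \<alpha>0 T \<omega> \<in> {p - \<epsilon><..<p + \<epsilon>}}) sequentially"
proof -
  define t where "t = sqrt (2 / (p\<^sup>2 / (\<sigma> 1)\<^sup>2 + (1 - p)\<^sup>2 / (\<sigma> 2)\<^sup>2))"
  note t = tilt_rate_sum[OF p sigmas t_def]
  have s: "t * p > 0" "t * (1 - p) > 0" using t(1) p by auto
  have "((\<lambda>z. fst z / (fst z + snd z)) \<longlongrightarrow> t * p / (t * p + t * (1 - p))) (nhds (t * p, t * (1 - p)))"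
    using s by (intro tendsto_intros tendsto_fst[where a = "(t * p, t * (1 - p))", simplified]
      tendsto_snd[where a = "(t * p, t * (1 - p))", simplified] filterlim_ident) auto
  moreover have "t * p / (t * p + t * (1 - p)) = p" using t(1) by (simp add: distrib_left[symmetric])
  ultimately have "eventually (\<lambda>z. fst z / (fst z + snd z) \<in> {p - \<epsilon><..<p + \<epsilon>}) (nhds (t * p, t * (1 - p)))"
    using \<epsilon> by (intro topological_tendstoD[of _ p]) auto
  then obtain d where d: "d > 0" "\<And>z. dist z (t * p, t * (1 - p)) < d \<Longrightarrow> fst z / (fst z + snd z) \<in> {p - \<epsilon><..<p + \<epsilon>}"
    unfolding eventually_nhds_metric by blast
  define \<epsilon>' where "\<epsilon>' = min (d / 2) \<eta>"
  have \<epsilon>': "\<epsilon>' > 0" "\<epsilon>' \<le> \<eta>" using d \<eta> by (auto simp: \<epsilon>'_def)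
  have near: "x / (x + y) \<in> {p - \<epsilon><..<p + \<epsilon>}" if "\<bar>x - t * p\<bar> < \<epsilon>'" "\<bar>y - t * (1 - p)\<bar> < \<epsilon>'" for x y
  proof -
    have "dist (x, y) (t * p, t * (1 - p)) \<le> \<bar>x - t * p\<bar> + \<bar>y - t * (1 - p)\<bar>"
      unfolding dist_prod_def by (simp add: dist_real_def sqrt_sum_squares_le_sum_abs)
    also have "\<dots> < d" using that by (auto simp: \<epsilon>'_def)
    finally show ?thesis using d(2)[of "(x, y)"] by simp
  qed
  have near_i: "eventually (\<lambda>T. exp (- (real (phase1_size \<alpha>0 T) * (tilt_rate (\<sigma> i) s + \<epsilon>')))
      \<le> prob {\<omega> \<in> space M. \<bar>sample_sd (\<lambda>k. X i k \<omega>) (phase1_size \<alpha>0 T) - s\<bar> < \<epsilon>'}) sequentially"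
    if "i \<in> {1, 2}" "s > 0" for i s
    using prob_sample_sd_near_ge[OF that \<epsilon>'(1)] filterlim_phase1_size[OF \<alpha>0] unfolding filterlim_iff by blast
  have "eventually (\<lambda>T. exp (- (real (phase1_size \<alpha>0 T) * (tilt_rate (\<sigma> 1) (t * p) + \<epsilon>')))
      \<le> prob {\<omega> \<in> space M. \<bar>sample_sd (\<lambda>k. X 1 k \<omega>) (phase1_size \<alpha>0 T) - t * p\<bar> < \<epsilon>'}) sequentially"
    "eventually (\<lambda>T. exp (- (real (phase1_size \<alpha>0 T) * (tilt_rate (\<sigma> 2) (t * (1 - p)) + \<epsilon>')))
      \<le> prob {\<omega> \<in> space M. \<bar>sample_sd (\<lambda>k. X 2 k \<omega>) (phase1_size \<alpha>0 T) - t * (1 - p)\<bar> < \<epsilon>'}) sequentially"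
    using near_i s by auto
  then show ?thesis
  proof eventually_elim
    case (elim T)
    define n where "n = phase1_size \<alpha>0 T"
    have lnR: "ln (R p) \<ge> 0" using one_le_imbalance[OF p sigmas] by simp
    have n: "real n \<le> \<alpha>0 * real T / 2" using phase1_size_bounds(2)[OF \<alpha>0] by (simp add: n_def)
    have "real n * (ln (R p) + 2 * \<epsilon>') \<le> \<alpha>0 * real T / 2 * (ln (R p) + 2 * \<epsilon>')"
      using n lnR \<epsilon>' by (intro mult_right_mono) auto
    also have "\<dots> = real T * (\<alpha>0 / 2 * ln (R p) + \<alpha>0 * \<epsilon>')" by (simp add: algebra_simps)
    also have "\<dots> \<le> real T * (\<alpha>0 / 2 * ln (R p) + \<eta>)"
    proof (intro mult_left_mono add_left_mono)
      have "\<alpha>0 * \<epsilon>' \<le> 1 * \<epsilon>'" using \<alpha>0 \<epsilon>' by (intro mult_right_mono) auto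
      then show "\<alpha>0 * \<epsilon>' \<le> \<eta>" using \<epsilon>' by linarith
    qed simp
    finally have "exp (- (real T * (\<alpha>0 / 2 * ln (R p) + \<eta>))) \<le> exp (- (real n * (ln (R p) + 2 * \<epsilon>')))" by simp
    also have "\<dots> = exp (- (real n * (tilt_rate (\<sigma> 1) (t * p) + \<epsilon>'))) * exp (- (real n * (tilt_rate (\<sigma> 2) (t * (1 - p)) + \<epsilon>')))"
      unfolding t(2)[symmetric] exp_add[symmetric] by (simp add: algebra_simps)
    also have "\<dots> \<le> prob {\<omega> \<in> space M. \<bar>sample_sd (\<lambda>k. X 1 k \<omega>) n - t * p\<bar> < \<epsilon>'}
        * prob {\<omega> \<in> space M. \<bar>sample_sd (\<lambda>k. X 2 k \<omega>) n - t * (1 - p)\<bar> < \<epsilon>'}"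
      using elim unfolding n_def by (intro mult_mono) auto
    also have "\<dots> = prob {\<omega> \<in> space M. sample_sd (\<lambda>k. X 1 k \<omega>) n \<in> {x. \<bar>x - t * p\<bar> < \<epsilon>'}
        \<and> sample_sd (\<lambda>k. X 2 k \<omega>) n \<in> {x. \<bar>x - t * (1 - p)\<bar> < \<epsilon>'}}"
      by (subst prob_indep_random_variable[OF indep_sample_sd]) auto
    also have "\<dots> \<le> prob {\<omega> \<in> space M. p_est \<alpha>0 T \<omega> \<in> {p - \<epsilon><..<p + \<epsilon>}}"
    proof (rule finite_measure_mono)
      show "{\<omega> \<in> space M. sample_sd (\<lambda>k. X 1 k \<omega>) n \<in> {x. \<bar>x - t * p\<bar> < \<epsilon>'}
          \<and> sample_sd (\<lambda>k. X 2 k \<omega>) n \<in> {x. \<bar>x - t * (1 - p)\<bar> < \<epsilon>'}}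
        \<subseteq> {\<omega> \<in> space M. p_est \<alpha>0 T \<omega> \<in> {p - \<epsilon><..<p + \<epsilon>}}"
        unfolding p_est_def p_hat_def n_def[symmetric] using near by blast
    qed measurable
    finally show ?case .
  qed
qed

text \<open>
  Larger samples make a false selection less likely, so upper bounds on the sample sizes are what
  is needed here. With \<open>c\<close> proportional to the budget, the exponent is linear in \<open>c\<close> up to a term of
  order \<open>sqrt c\<close>.
\<close>
lemma prob_mean_gap_ge:
  assumes ab: "a > 0" "b > 0" and x: "x > 0" "real a \<le> c * x" and y: "y > 0" "real b \<le> c * y" and c: "c > 0"
  shows "exp (- ((sqrt c * (\<delta> / sqrt ((\<sigma> 1)\<^sup>2 / x + (\<sigma> 2)\<^sup>2 / y)) + 1)\<^sup>2 / 2)) / sqrt (2 * pi)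
    \<le> prob {\<omega> \<in> space M. 0 < mean_gap n a b \<omega>}"
proof -
  define v where "v = (\<sigma> 1)\<^sup>2 / real a + (\<sigma> 2)\<^sup>2 / real b"
  have v: "v > 0" unfolding v_def using ab sigmas by (intro add_pos_pos) auto
  define V where "V = (\<sigma> 1)\<^sup>2 / x + (\<sigma> 2)\<^sup>2 / y"
  have V: "V > 0" unfolding V_def using x y sigmas by (intro add_pos_pos) auto
  have "V / c = (\<sigma> 1)\<^sup>2 / (c * x) + (\<sigma> 2)\<^sup>2 / (c * y)" by (simp add: V_def add_divide_distrib mult.commute)
  also have "\<dots> \<le> v" unfolding v_def using ab x y c by (intro add_mono divide_left_mono) auto
  finally have "sqrt (V / c) \<le> sqrt v" by simp
  then have "\<delta> / sqrt v \<le> \<delta> / sqrt (V / c)" using \<delta> v V c by (intro divide_left_mono) auto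
  also have "\<dots> = sqrt c * (\<delta> / sqrt V)" by (simp add: real_sqrt_divide)
  finally have "(\<delta> / sqrt v + 1)\<^sup>2 \<le> (sqrt c * (\<delta> / sqrt V) + 1)\<^sup>2"
    using \<delta> v by (intro power_mono) auto
  then have "exp (- ((sqrt c * (\<delta> / sqrt V) + 1)\<^sup>2 / 2)) / sqrt (2 * pi) \<le> exp (- ((\<delta> / sqrt v + 1)\<^sup>2 / 2)) / sqrt (2 * pi)"
    by (intro divide_right_mono) auto
  also have "\<dots> \<le> prob {\<omega> \<in> space M. 0 < mean_gap n a b \<omega>}"
    using mean_gap_normal[OF ab, of n] \<delta> v unfolding v_def[symmetric] by (intro normal_prob_pos) auto
  finally show ?thesis by (simp only: V_def)
qed

lemma PFS_lower:
  assumes p: "p \<in> {0<..<1}" and \<eta>: "\<eta> > 0"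
  shows "eventually (\<lambda>T. exp (- (real T * (G p + \<alpha>0 / 2 * ln (R p) + \<eta>))) \<le> PFS M X \<alpha>0 T) sequentially"
proof -
  define a where "a = 1 - \<alpha>0"
  have a: "a > 0" using \<alpha>0 by (simp add: a_def)
  have "((\<lambda>\<epsilon>. a * \<delta>\<^sup>2 / (2 * ((\<sigma> 1)\<^sup>2 / (p + 2 * \<epsilon>) + (\<sigma> 2)\<^sup>2 / (1 - p + 2 * \<epsilon>))))
      \<longlongrightarrow> a * \<delta>\<^sup>2 / (2 * ((\<sigma> 1)\<^sup>2 / (p + 2 * 0) + (\<sigma> 2)\<^sup>2 / (1 - p + 2 * 0)))) (at_right 0)"
  proof (intro tendsto_intros)
    have "(\<sigma> 1)\<^sup>2 / p + (\<sigma> 2)\<^sup>2 / (1 - p) > 0" using p sigmas by (intro add_pos_pos) auto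
    then show "2 * ((\<sigma> 1)\<^sup>2 / (p + 2 * 0) + (\<sigma> 2)\<^sup>2 / (1 - p + 2 * 0)) \<noteq> 0" by simp
  qed (use p in auto)
  also have "a * \<delta>\<^sup>2 / (2 * ((\<sigma> 1)\<^sup>2 / (p + 2 * 0) + (\<sigma> 2)\<^sup>2 / (1 - p + 2 * 0))) = G p"
    using selection_exponent_eq[OF p sigmas] by (simp add: a_def)
  finally have lim: "((\<lambda>\<epsilon>. a * \<delta>\<^sup>2 / (2 * ((\<sigma> 1)\<^sup>2 / (p + 2 * \<epsilon>) + (\<sigma> 2)\<^sup>2 / (1 - p + 2 * \<epsilon>)))) \<longlongrightarrow> G p) (at_right 0)" .
  have "eventually (\<lambda>\<epsilon>. a * \<delta>\<^sup>2 / (2 * ((\<sigma> 1)\<^sup>2 / (p + 2 * \<epsilon>) + (\<sigma> 2)\<^sup>2 / (1 - p + 2 * \<epsilon>))) < G p + \<eta> / 4) (at_right 0)"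
    by (rule order_tendstoD(2)[OF lim]) (use \<eta> in simp)
  moreover have "eventually (\<lambda>\<epsilon>::real. \<epsilon> > 0) (at_right 0)" by (simp add: eventually_at_right_less)
  ultimately have "eventually (\<lambda>\<epsilon>. \<epsilon> > 0 \<and> a * \<delta>\<^sup>2 / (2 * ((\<sigma> 1)\<^sup>2 / (p + 2 * \<epsilon>) + (\<sigma> 2)\<^sup>2 / (1 - p + 2 * \<epsilon>))) < G p + \<eta> / 4) (at_right 0)"
    by eventually_elim auto
  then obtain \<epsilon> where \<epsilon>: "\<epsilon> > 0" "a * \<delta>\<^sup>2 / (2 * ((\<sigma> 1)\<^sup>2 / (p + 2 * \<epsilon>) + (\<sigma> 2)\<^sup>2 / (1 - p + 2 * \<epsilon>))) < G p + \<eta> / 4"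
    using eventually_happens'[OF trivial_limit_at_right_real] by blast
  \<comment> \<open>In the window of radius \<open>\<epsilon>\<close> the fraction of design 1 is below \<open>p + \<epsilon>\<close>; the second \<open>\<epsilon>\<close> absorbs the
    additional replication from rounding, and likewise for design 2.\<close>
  define x y V where "x = p + 2 * \<epsilon>" and "y = 1 - p + 2 * \<epsilon>" and "V = (\<sigma> 1)\<^sup>2 / x + (\<sigma> 2)\<^sup>2 / y"
  have xy: "x > 0" "y > 0" using p \<epsilon> by (auto simp: x_def y_def)
  have V: "V > 0" unfolding V_def using xy sigmas by (intro add_pos_pos) auto
  have GV: "a * \<delta>\<^sup>2 / (2 * V) < G p + \<eta> / 4" using \<epsilon>(2) by (simp add: V_def x_def y_def)
  define k where "k = sqrt a * (\<delta> / sqrt V)"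
  have k: "k > 0" using a \<delta> V by (simp add: k_def)
  have k2: "k\<^sup>2 / 2 = a * \<delta>\<^sup>2 / (2 * V)" using a V by (simp add: k_def power_mult_distrib power_divide)
  define C where "C = {p - \<epsilon><..<p + \<epsilon>}"
  have "filterlim (\<lambda>T. \<eta> / 4 * real T - k * sqrt (real T)) at_top sequentially" using \<eta> k by real_asymp
  then have "eventually (\<lambda>T. 1 / 2 + ln (sqrt (2 * pi)) \<le> \<eta> / 4 * real T - k * sqrt (real T)) sequentially"
    by (auto simp: filterlim_at_top)
  moreover have "filterlim (\<lambda>T. a * \<epsilon> * real T) at_top sequentially" using a \<epsilon> by real_asymp
  then have "eventually (\<lambda>T. 1 \<le> a * \<epsilon> * real T) sequentially" by (auto simp: filterlim_at_top)
  moreover note prob_p_est_near_ge[OF p \<epsilon>(1) half_gt_zero[OF \<eta>], folded C_def]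
  ultimately show ?thesis using eventually_gt_at_top[of 0]
  proof eventually_elim
    case (elim T)
    define c where "c = exp (- ((k * sqrt (real T) + 1)\<^sup>2 / 2)) / sqrt (2 * pi)"
    have "c \<ge> 0" by (simp add: c_def)
    have gap: "c \<le> prob {\<omega> \<in> space M. 0 < mean_gap (phase1_size \<alpha>0 T) (allocation \<alpha>0 T 1 q) (allocation \<alpha>0 T 2 q) \<omega>}"
      if q: "q \<in> C" "q \<in> {0..1}" for q
    proof -
      define n1 n2 where "n1 = allocation \<alpha>0 T 1 q" and "n2 = allocation \<alpha>0 T 2 q"
      have n: "n1 > 0" "n2 > 0" "real n1 \<le> a * q * real T + 1" "real n2 \<le> a * (1 - q) * real T + 1"
        using allocation_bounds[OF q(2) \<alpha>0, where i = 1 and T = T] allocation_bounds[OF q(2) \<alpha>0, where i = 2 and T = T]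
        by (auto simp: n1_def n2_def a_def)
      have "a * real T * q \<le> a * real T * (p + \<epsilon>)" "a * real T * (1 - q) \<le> a * real T * (1 - p + \<epsilon>)"
        using q a by (auto simp: C_def intro!: mult_left_mono)
      then have le: "real n1 \<le> a * real T * x" "real n2 \<le> a * real T * y"
        using n elim(2) by (auto simp: x_def y_def algebra_simps)
      have "k * sqrt (real T) = sqrt (a * real T) * (\<delta> / sqrt ((\<sigma> 1)\<^sup>2 / x + (\<sigma> 2)\<^sup>2 / y))"
        by (simp add: k_def V_def real_sqrt_mult)
      then show ?thesis unfolding c_def n1_def[symmetric] n2_def[symmetric]
        using prob_mean_gap_ge[OF n(1,2) xy(1) le(1) xy(2) le(2)] a elim(4) by simp
    qed
    have "exp (- (real T * (G p + \<eta> / 2))) \<le> c"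
    proof -
      have "(k * sqrt (real T) + 1)\<^sup>2 / 2 + ln (sqrt (2 * pi)) = real T * (k\<^sup>2 / 2) + (k * sqrt (real T) + (1 / 2 + ln (sqrt (2 * pi))))"
        by (simp add: power2_sum power_mult_distrib)
      also have "\<dots> \<le> real T * (G p + \<eta> / 4) + \<eta> / 4 * real T"
        using GV elim(1) unfolding k2[symmetric] by (intro add_mono mult_left_mono) auto
      also have "\<dots> = real T * (G p + \<eta> / 2)" by (simp add: algebra_simps)
      finally have "exp (- (real T * (G p + \<eta> / 2))) \<le> exp (- ((k * sqrt (real T) + 1)\<^sup>2 / 2) - ln (sqrt (2 * pi)))" by simp
      also have "\<dots> = c" unfolding c_def by (simp add: exp_diff)
      finally show ?thesis .
    qed
    then have "exp (- (real T * (G p + \<eta> / 2))) * exp (- (real T * (\<alpha>0 / 2 * ln (R p) + \<eta> / 2)))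
        \<le> c * prob {\<omega> \<in> space M. p_est \<alpha>0 T \<omega> \<in> C}"
      using elim(3) \<open>c \<ge> 0\<close> by (intro mult_mono) auto
    also have "\<dots> \<le> prob {\<omega> \<in> space M. p_est \<alpha>0 T \<omega> \<in> C \<and> false_selection \<alpha>0 T \<omega>}"
      by (rule prob_false_selection_ge[OF \<alpha>0 _ gap]) (simp_all add: C_def)
    also have "\<dots> \<le> PFS M X \<alpha>0 T"
      unfolding PFS_def false_selection_def[symmetric]
      using prob_false_selection_decomp(3)[OF \<alpha>0, where C = UNIV and T = T, OF _ refl refl]
      by (intro finite_measure_mono) auto
    finally show ?case by (simp add: exp_add[symmetric] algebra_simps)
  qed
qed

section \<open>The exponential decay rate\<close>

lemma PFS_limit:
  assumes p: "p \<in> {0<..<1}"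
    and min: "\<And>q. q \<in> {0<..<1} \<Longrightarrow> G p + \<alpha>0 / 2 * ln (R p) \<le> G q + \<alpha>0 / 2 * ln (R q)"
  shows "(\<lambda>T. - (1 / real T * ln (PFS M X \<alpha>0 T))) \<longlonglongrightarrow> G p + \<alpha>0 / 2 * ln (R p)"
proof (rule tendstoI)
  define F where "F = G p + \<alpha>0 / 2 * ln (R p)"
  fix e :: real assume "e > 0"
  then have h: "e / 2 > 0" by simp
  have "eventually (\<lambda>T. PFS M X \<alpha>0 T \<le> exp (- (real T * (F - e / 2)))) sequentially"
    by (rule PFS_upper[OF _ h]) (use min in \<open>simp add: F_def\<close>)
  with PFS_lower[OF p h, folded F_def] eventually_gt_at_top[of 0]
  show "eventually (\<lambda>T. dist (- (1 / real T * ln (PFS M X \<alpha>0 T))) (G p + \<alpha>0 / 2 * ln (R p)) < e) sequentially"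
    unfolding F_def[symmetric]
  proof eventually_elim
    case (elim T)
    define P where "P = PFS M X \<alpha>0 T"
    have P: "P > 0" using elim(1) unfolding P_def by (rule less_le_trans[OF exp_gt_zero])
    have "- (real T * (F + e / 2)) \<le> ln P" using elim(1) P by (simp add: P_def ln_ge_iff)
    then have "- ln P \<le> (F + e / 2) * real T" by (simp add: algebra_simps)
    then have "- ln P / real T \<le> F + e / 2" using elim(2) by (simp only: pos_divide_le_eq of_nat_0_less_iff)
    moreover have "ln P \<le> - (real T * (F - e / 2))" using elim(3) P unfolding P_def[symmetric]
      by (metis exp_gt_zero ln_exp ln_le_cancel_iff)
    then have "(F - e / 2) * real T \<le> - ln P" by (simp add: algebra_simps)
    then have "F - e / 2 \<le> - ln P / real T" using elim(2) by (simp only: pos_le_divide_eq of_nat_0_less_iff)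
    ultimately have "\<bar>- ln P / real T - F\<bar> < e" using \<open>e > 0\<close> by linarith
    then show ?case by (simp add: P_def dist_real_def)
  qed
qed

end

theorem theorem4p2:
  fixes M :: "'a measure" and X :: "nat \<Rightarrow> nat \<Rightarrow> 'a \<Rightarrow> real"
    and \<mu> \<sigma> :: "nat \<Rightarrow> real" and \<delta> \<alpha>0 :: real
  assumes "prob_space M"
    and "prob_space.indep_vars M (\<lambda>_. borel) (\<lambda>(i, k). X i k) ({1, 2} \<times> UNIV)"
    and "\<And>i k. i \<in> {1, 2} \<Longrightarrow> distributed M lborel (X i k) (normal_density (\<mu> i) (\<sigma> i))"
    and "\<mu> 1 > \<mu> 2" and "\<delta> = \<mu> 1 - \<mu> 2"
    and "\<sigma> 1 > 0" and "\<sigma> 2 > 0"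
    and "\<alpha>0 \<in> {0<..<1}"
  shows "\<exists>p\<in>{0..1}.
    (\<forall>q\<in>{0..1}. rate_objective \<alpha>0 \<delta> (\<sigma> 1) (\<sigma> 2) p \<le> rate_objective \<alpha>0 \<delta> (\<sigma> 1) (\<sigma> 2) q) \<and>
    (\<lambda>T. ereal (- (1 / real T * ln (PFS M X \<alpha>0 T))))
      \<longlonglongrightarrow> rate_objective \<alpha>0 \<delta> (\<sigma> 1) (\<sigma> 2) p"
proof -
  interpret prob_space M by fact
  interpret two_phase M X \<mu> \<sigma> \<delta> \<alpha>0
    by unfold_locales (use assms in auto)
  obtain p where p: "p \<in> {0<..<1}"
    and min: "\<And>q. q \<in> {0<..<1} \<Longrightarrow> G p + \<alpha>0 / 2 * ln (R p) \<le> G q + \<alpha>0 / 2 * ln (R q)"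
    using rate_minimizer[OF sigmas \<alpha>0 refl, of \<delta>] by blast
  show ?thesis
  proof (intro bexI[of _ p] conjI ballI)
    fix q :: real assume "q \<in> {0..1}"
    then consider "q = 0 \<or> q = 1" | "q \<in> {0<..<1}" by fastforce
    then show "rate_objective \<alpha>0 \<delta> (\<sigma> 1) (\<sigma> 2) p \<le> rate_objective \<alpha>0 \<delta> (\<sigma> 1) (\<sigma> 2) q"
    proof cases
      case 1
      then have "rate_objective \<alpha>0 \<delta> (\<sigma> 1) (\<sigma> 2) q = \<infinity>" by (auto simp: rate_objective_def)
      then show ?thesis by simp
    next
      case 2
      show ?thesis
        unfolding rate_objective_interior[OF p sigmas] rate_objective_interior[OF 2 sigmas] using min[OF 2] by simp
    qed
  next
    show "(\<lambda>T. ereal (- (1 / real T * ln (PFS M X \<alpha>0 T)))) \<longlonglongrightarrow> rate_objective \<alpha>0 \<delta> (\<sigma> 1) (\<sigma> 2) p"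
      unfolding rate_objective_interior[OF p sigmas] using PFS_limit[OF p min] by (rule tendsto_ereal)
  qed (use p in auto)
qed

end
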